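(* Let $G$ be a finite simple bipartite graph with edge ideal $I(G)$. Then for all integers $s \geq 1$, $$\operatorname{reg}(I(G)^s) \leq 2s + \operatorname{co-chord}(G) - 1.$$
   Context: Graphs are finite, simple and undirected. For a graph $G$ with vertex set $\{x_1,\ldots,x_n\}$ and a field $k$, the edge ideal is the monomial ideal $I(G) = (x_ix_j \mid \{x_i,x_j\}\in E(G)) \subseteq k[x_1,\ldots,x_n]$. $\operatorname{reg}$ denotes Castelnuovo-Mumford regularity of a homogeneous ideal. A graph is chordal if every induced cycle in it has length $3$; a graph is co-chordal if its complement is chordal. The co-chordal cover number $\operatorname{co-chord}(G)$ is the minimum number $n$ such that there exist co-chordal subgraphs $H_1,\ldots,H_n$ of $G$ (not necessarily induced) with $E(G)=\bigcup_{i=1}^n E(H_i)$. *)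

theory Defs
  imports Complex_Main "HOL-Library.Poly_Mapping" "HOL-Library.Extended_Real"
begin

section \<open>Finite simple graphs and co-chordal covers\<close>

record 'v ugraph =
  verts :: "'v set"
  edges :: "'v set set"

definition simple_graph :: "'v ugraph \<Rightarrow> bool" where
  "simple_graph G \<longleftrightarrow>
     finite (verts G) \<and> (\<forall>e\<in>edges G. e \<subseteq> verts G \<and> card e = 2)"

definition subgraph :: "'v ugraph \<Rightarrow> 'v ugraph \<Rightarrow> bool" where
  "subgraph H G \<longleftrightarrow> simple_graph H \<and> verts H \<subseteq> verts G \<and> edges H \<subseteq> edges G"

definition bipartite :: "'v ugraph \<Rightarrow> bool" where
  "bipartite G \<longleftrightarrow>
     (\<exists>A B. A \<union> B = verts G \<and> A \<inter> B = {} \<and> (\<forall>e\<in>edges G. \<exists>a\<in>A. \<exists>b\<in>B. e = {a, b}))"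

definition complement_graph :: "'v ugraph \<Rightarrow> 'v ugraph" where
  "complement_graph G =
     \<lparr>verts = verts G, edges = {e. e \<subseteq> verts G \<and> card e = 2} - edges G\<rparr>"

text \<open>A list of distinct vertices whose induced subgraph is the cycle running through the
  list in cyclic order.\<close>

definition induced_cycle :: "'v ugraph \<Rightarrow> 'v list \<Rightarrow> bool" where
  "induced_cycle G c \<longleftrightarrow>
     length c \<ge> 3 \<and> distinct c \<and> set c \<subseteq> verts G \<and>
     (\<forall>i<length c. \<forall>j<length c.
        {c ! i, c ! j} \<in> edges G \<longleftrightarrow>
          j = (i + 1) mod length c \<or> i = (j + 1) mod length c)"

definition chordal :: "'v ugraph \<Rightarrow> bool" where
  "chordal G \<longleftrightarrow> (\<forall>c. induced_cycle G c \<longrightarrow> length c = 3)"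

text \<open>The complement is taken within the graph's own vertex set; in
  \<open>co_chord\<close> below, the subgraphs \<open>H i\<close> need not be spanning.\<close>

definition co_chordal :: "'v ugraph \<Rightarrow> bool" where
  "co_chordal G \<longleftrightarrow> chordal (complement_graph G)"

definition co_chord :: "'v ugraph \<Rightarrow> nat" where
  "co_chord G =
     (LEAST n. \<exists>H. (\<forall>i<n. subgraph (H i) G \<and> co_chordal (H i)) \<and>
                    edges G = (\<Union>i<n. edges (H i)))"

section \<open>Edge ideals and powers\<close>

text \<open>The polynomial ring over \<open>'k\<close> whose variables are the elements of \<open>'v\<close>:
  monomials are exponent vectors \<open>'v \<Rightarrow>\<^sub>0 nat\<close>.\<close>

type_synonym ('v, 'k) mpoly = "('v \<Rightarrow>\<^sub>0 nat) \<Rightarrow>\<^sub>0 'k"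

definition X :: "'v \<Rightarrow> ('v, 'k::comm_ring_1) mpoly" where
  "X v = Poly_Mapping.single (Poly_Mapping.single v 1) 1"

text \<open>The submodules of a commutative ring over itself are its ideals.\<close>

abbreviation ideal_gen :: "'a::comm_ring_1 set \<Rightarrow> 'a set" where
  "ideal_gen \<equiv> module.span (*)"

definition ideal_mult :: "'a::comm_ring_1 set \<Rightarrow> 'a set \<Rightarrow> 'a set" where
  "ideal_mult I J = ideal_gen {a * b | a b. a \<in> I \<and> b \<in> J}"

primrec ideal_power :: "'a::comm_ring_1 set \<Rightarrow> nat \<Rightarrow> 'a set" where
  "ideal_power I 0 = UNIV"
| "ideal_power I (Suc s) = ideal_mult I (ideal_power I s)"

definition edge_ideal :: "'v ugraph \<Rightarrow> ('v, 'k::comm_ring_1) mpoly set" where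
  "edge_ideal G = ideal_gen {X u * X v | u v. {u, v} \<in> edges G}"

section \<open>Minimal graded free resolutions and regularity\<close>

definition mdeg :: "('v \<Rightarrow>\<^sub>0 nat) \<Rightarrow> nat" where
  "mdeg m = (\<Sum>v\<in>Poly_Mapping.keys m. Poly_Mapping.lookup m v)"

text \<open>The zero polynomial is homogeneous of every degree, and is the only one that is
  homogeneous of a negative degree.\<close>

definition homogeneous :: "int \<Rightarrow> ('v, 'k::zero) mpoly \<Rightarrow> bool" where
  "homogeneous d p \<longleftrightarrow> (\<forall>m\<in>Poly_Mapping.keys p. int (mdeg m) = d)"

text \<open>
  Data of a complex \<open>\<dots> \<rightarrow> F\<^sub>2 \<rightarrow> F\<^sub>1 \<rightarrow> F\<^sub>0 \<rightarrow> S\<close> over the polynomial ring \<open>S\<close> (the type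
  \<open>'a\<close>), where \<open>F\<^sub>i\<close> is the direct sum of the twists \<open>S(-shift i a)\<close> over \<open>a < rnk i\<close>; so the \<open>a\<close>-th basis
  vector of \<open>F\<^sub>i\<close> has degree \<open>shift i a\<close>. It is sent to \<open>aug a\<close> if \<open>i = 0\<close>, and to the
  vector \<open>bdry j a\<close> of \<open>F\<^sub>j\<close> if \<open>i = Suc j\<close>.
\<close>

record 'a free_complex =
  rnk :: "nat \<Rightarrow> nat"
  shift :: "nat \<Rightarrow> nat \<Rightarrow> int"
  aug :: "nat \<Rightarrow> 'a"
  bdry :: "nat \<Rightarrow> nat \<Rightarrow> nat \<Rightarrow> 'a"

definition free_mod :: "'a::comm_ring_1 free_complex \<Rightarrow> nat \<Rightarrow> (nat \<Rightarrow> 'a) set" where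
  "free_mod F i = {w. \<forall>a\<ge>rnk F i. w a = 0}"

definition aug_map :: "'a::comm_ring_1 free_complex \<Rightarrow> (nat \<Rightarrow> 'a) \<Rightarrow> 'a" where
  "aug_map F w = (\<Sum>a<rnk F 0. w a * aug F a)"

definition bdry_map ::
  "'a::comm_ring_1 free_complex \<Rightarrow> nat \<Rightarrow> (nat \<Rightarrow> 'a) \<Rightarrow> nat \<Rightarrow> 'a" where
  "bdry_map F i w =
     (\<lambda>b. if b < rnk F i then \<Sum>a<rnk F (Suc i). w a * bdry F i a b else 0)"

definition graded_free_resolution ::
  "('v, 'k::comm_ring_1) mpoly set \<Rightarrow> ('v, 'k) mpoly free_complex \<Rightarrow> bool" where
  "graded_free_resolution I F \<longleftrightarrow>
     (\<forall>a<rnk F 0. homogeneous (shift F 0 a) (aug F a)) \<and>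
     (\<forall>i. \<forall>a<rnk F (Suc i). \<forall>b<rnk F i.
        homogeneous (shift F (Suc i) a - shift F i b) (bdry F i a b)) \<and>
     aug_map F ` free_mod F 0 = I \<and>
     bdry_map F 0 ` free_mod F 1 = {w \<in> free_mod F 0. aug_map F w = 0} \<and>
     (\<forall>i. bdry_map F (Suc i) ` free_mod F (Suc (Suc i)) =
          {w \<in> free_mod F (Suc i). bdry_map F i w = (\<lambda>_. 0)})"

text \<open>Minimality: the image of each \<open>F\<^sub>i\<^sub>+\<^sub>1\<close> lies in \<open>\<mm> F\<^sub>i\<close>, \<open>\<mm>\<close> being the ideal generated
  by the variables; that is, all matrix entries have zero constant coefficient.\<close>

definition minimal_graded_free_resolution ::
  "('v, 'k::comm_ring_1) mpoly set \<Rightarrow> ('v, 'k) mpoly free_complex \<Rightarrow> bool" where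
  "minimal_graded_free_resolution I F \<longleftrightarrow>
     graded_free_resolution I F \<and>
     (\<forall>i. \<forall>a<rnk F (Suc i). \<forall>b<rnk F i. Poly_Mapping.lookup (bdry F i a b) 0 = 0)"

text \<open>A homogeneous ideal in finitely many variables over a field has a minimal graded free
  resolution, unique up to isomorphism, so the choice below is immaterial.\<close>

definition graded_betti :: "('v, 'k::field) mpoly set \<Rightarrow> nat \<Rightarrow> int \<Rightarrow> nat" where
  "graded_betti I i j =
     (let F = (SOME F. minimal_graded_free_resolution I F)
      in card {a. a < rnk F i \<and> shift F i a = j})"

text \<open>The supremum is a maximum for a nonzero homogeneous ideal; the zero ideal has
  regularity \<open>-\<infinity>\<close>.\<close>

definition regularity :: "('v, 'k::field) mpoly set \<Rightarrow> ereal" where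
  "regularity I = Sup {ereal (real_of_int (j - int i)) | i j. graded_betti I i j \<noteq> 0}"

end

theory Submission
  imports Defs "HOL-Library.Function_Algebras" "HOL-Library.Countable"
begin

text \<open>The proof reduces powers of edge ideals to edge ideals of other bipartite graphs by colon ideals of
monomials, and it measures regularity by multigraded Koszul homology, where the short exact
sequences of colon ideals become elementary.

\<^bold>\<open>Regularity.\<close> A monomial ideal is given by its up-closed set \<open>U\<close> of exponent vectors. In multidegree
\<open>b\<close> its Koszul complex is the chain complex of the simplicial complex of all faces \<open>T\<close> with
\<open>b - ind T \<in> U\<close>, and \<open>reg_le k U r\<close> says that this complex is exact at the faces of size \<open>p\<close> whenever
the degree of \<open>b\<close> exceeds \<open>p + r\<close>. The bridge to resolutions is dimension shifting: since the Koszul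
complex of a free module is acyclic, such a vanishing for a graded module passes to the syzygies of a
minimal presentation with the bound raised by one (\<open>tor_bound_syz\<close>), while vanishing at \<open>p = 0\<close> forces
the generators into low degrees, by the argument of Nakayama's lemma
(\<open>minimal_presentation_shift_le\<close>). The same vanishing makes every syzygy module finitely generated, so
a minimal resolution exists, and every minimal resolution satisfies the bound (\<open>regularity_le\<close>).

\<^bold>\<open>Colon ideals.\<close> The key inequality \<open>reg U \<le> max (reg (U : m) + deg m) (reg (U + (m)))\<close> is
\<open>reg_le_colon_sum\<close>.

\<^bold>\<open>One graph.\<close> A co-chordal subgraph of a bipartite graph has no induced pair of disjoint edges,
for these would span an induced four-cycle in the complement; so it is a chain graph: the
neighbourhoods of the left vertices are nested. If \<open>E\<close> is covered by \<open>n\<close> chain graphs, then its edge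
ideal has regularity at most \<open>n + 1\<close> (\<open>reg_le_graph\<close>): taking the colon with a left vertex whose
neighbourhood in the last chain graph is largest turns all these neighbours into generators and thus
kills that chain graph, and adding the vertex to the ideal makes the graph smaller.

\<^bold>\<open>Powers.\<close> Pass from \<open>I\<^sup>s\<^sup>+\<^sup>1\<close> to \<open>I\<^sup>s\<close> by adding the generators \<open>M\<close> of \<open>I\<^sup>s\<close> in lexicographically
descending order. An exchange property of bipartite edge multisets (\<open>exchange\<close>, an alternating path
argument) shows that the colon ideal with \<open>M\<close> that occurs is generated by some variables and the
edges of the graph \<open>link s M\<close> of all \<open>(a, b)\<close> with \<open>M x\<^sub>a x\<^sub>b \<in> I\<^sup>s\<^sup>+\<^sup>1\<close> (\<open>colon_lex_segment\<close>). By the same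
property, multiplying \<open>M\<close> by an edge \<open>xy\<close> joins all neighbours of \<open>y\<close> to all neighbours of \<open>x\<close>
(\<open>link_Suc\<close>), and a cover by \<open>n\<close> chain graphs extends along this operation (\<open>chain_cover_step\<close>). Hence
all these colon ideals have regularity at most \<open>n + 1\<close>, so
\<open>reg I\<^sup>s\<^sup>+\<^sup>1 \<le> max (reg I\<^sup>s) (2 s + n + 1)\<close>, and the bound follows by induction.\<close>

section \<open>The Koszul differential\<close>

definition koszul_sign :: "'v::finite \<Rightarrow> 'v set \<Rightarrow> 'r::comm_ring_1" where
  "koszul_sign v S = (- 1) ^ card {w \<in> S. to_nat w < to_nat v}"

text \<open>With \<open>y = X\<close> this is the differential of the Koszul complex of the variables; with \<open>y = 1\<close> it is the
simplicial boundary, to which the former restricts in each multidegree.\<close>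

definition koszul_diff ::
  "('v::finite \<Rightarrow> 'r::comm_ring_1) \<Rightarrow> ('v set \<Rightarrow> 'r) \<Rightarrow> 'v set \<Rightarrow> 'r" where
  "koszul_diff y c S = (\<Sum>v\<in>- S. koszul_sign v S * y v * c (insert v S))"

lemma koszul_sign_square: "koszul_sign v S * koszul_sign v S = 1"
  unfolding koszul_sign_def by (simp flip: power_mult_distrib)

lemma koszul_sign_insert:
  assumes "w \<notin> S" "v \<noteq> w"
  shows "koszul_sign v (insert w S) =
    (if to_nat w < to_nat v then - koszul_sign v S else koszul_sign v S)"
proof (cases "to_nat w < to_nat v")
  case True
  then have "{u \<in> insert w S. to_nat u < to_nat v} = insert w {u \<in> S. to_nat u < to_nat v}"
    by auto
  with True assms show ?thesis by (simp add: koszul_sign_def)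
next
  case False
  then have "{u \<in> insert w S. to_nat u < to_nat v} = {u \<in> S. to_nat u < to_nat v}"
    by auto
  with False show ?thesis by (simp add: koszul_sign_def)
qed

text \<open>Exactly one of \<open>v\<close> and \<open>w\<close> precedes the other, so the presence of one changes the sign of the other in
just one of the two orders of inserting them.\<close>

lemma koszul_sign_swap:
  fixes v w :: "'v::finite"
  assumes "v \<noteq> w" "v \<notin> S" "w \<notin> S"
  shows "koszul_sign w S * koszul_sign v (insert w S) =
    - (koszul_sign v S * koszul_sign w (insert v S) :: 'r::comm_ring_1)"
proof -
  have "to_nat v < to_nat w \<or> to_nat w < to_nat v"
    using assms(1) by (metis linorder_neq_iff inj_to_nat injD)
  then show ?thesis
    using assms by (auto simp: koszul_sign_insert)
qed

text \<open>The summand that inserts \<open>v\<close> and then \<open>w\<close> cancels against the one that inserts \<open>w\<close> and then \<open>v\<close>.\<close>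

lemma koszul_diff_diff:
  fixes y :: "'v::finite \<Rightarrow> 'r::comm_ring_1"
  shows "koszul_diff y (koszul_diff y c) S = 0"
proof -
  let ?P = "{(v, w). v \<notin> S \<and> w \<notin> S \<and> v \<noteq> w}"
  let ?t = "\<lambda>v w. koszul_sign v S * koszul_sign w (insert v S) * (y v * y w * c (insert w (insert v S)))"
  let ?L = "{(v, w). v \<notin> S \<and> w \<notin> S \<and> to_nat v < to_nat w}"
  let ?G = "{(v, w). v \<notin> S \<and> w \<notin> S \<and> to_nat w < to_nat v}"
  have P: "?P = ?L \<union> ?G"
    by (auto simp: linorder_neq_iff dest: injD[OF inj_to_nat] intro: ccontr)
  have "koszul_diff y (koszul_diff y c) S =
      (\<Sum>v\<in>- S. \<Sum>w\<in>- insert v S. ?t v w)"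
    unfolding koszul_diff_def by (simp add: sum_distrib_left mult_ac)
  also have "\<dots> = (\<Sum>(v, w)\<in>Sigma (- S) (\<lambda>v. - insert v S). ?t v w)"
    by (simp add: sum.Sigma)
  also have "Sigma (- S) (\<lambda>v. - insert v S) = ?P"
    by auto
  also have "(\<Sum>(v, w)\<in>?P. ?t v w) = (\<Sum>(v, w)\<in>?L. ?t v w) + (\<Sum>(v, w)\<in>?G. ?t v w)"
    unfolding P by (rule sum.union_disjoint) auto
  also have "(\<Sum>(v, w)\<in>?G. ?t v w) = (\<Sum>(v, w)\<in>?L. ?t w v)"
    by (rule sum.reindex_bij_witness[of _ "\<lambda>(v, w). (w, v)" "\<lambda>(v, w). (w, v)"]) auto
  also have "\<dots> = (\<Sum>(v, w)\<in>?L. - ?t v w)"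
  proof (rule sum.cong[OF refl], clarify)
    fix v w assume h: "v \<notin> S" "w \<notin> S" "to_nat v < to_nat w"
    then have "v \<noteq> w" by auto
    then show "?t w v = - ?t v w"
      using koszul_sign_swap[of v w S, where 'r='r] h by (simp add: insert_commute mult_ac)
  qed
  finally show ?thesis
    by (simp add: case_prod_unfold flip: sum.distrib)
qed

lemma koszul_diff_zero [simp]: "koszul_diff y (\<lambda>_. 0) = (\<lambda>_. 0)"
  by (simp add: koszul_diff_def fun_eq_iff)

lemma koszul_diff_minus:
  "koszul_diff y (\<lambda>T. c T - e T) S = koszul_diff y c S - koszul_diff y e S"
  by (simp add: koszul_diff_def algebra_simps sum_subtractf)

lemma koszul_diff_add:
  "koszul_diff y (\<lambda>T. c T + e T) S = koszul_diff y c S + koszul_diff y e S"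
  by (simp add: koszul_diff_def algebra_simps sum.distrib)

lemma koszul_diff_sum_mult:
  "koszul_diff y (\<lambda>T. \<Sum>a\<in>A. c T a * g a) S = (\<Sum>a\<in>A. koszul_diff y (\<lambda>T. c T a) S * g a)"
  unfolding koszul_diff_def
  by (subst sum_distrib_left, subst sum.swap) (simp add: sum_distrib_right sum_distrib_left mult_ac)

lemma koszul_diff_nonzero:
  assumes "koszul_diff y c S \<noteq> 0"
  obtains v where "v \<notin> S" "c (insert v S) \<noteq> 0"
proof -
  have "\<exists>v\<in>- S. koszul_sign v S * y v * c (insert v S) \<noteq> 0"
    using assms sum.neutral[of "- S" "\<lambda>v. koszul_sign v S * y v * c (insert v S)"]
    unfolding koszul_diff_def by blast
  then show ?thesis using that by fastforce
qed

section \<open>Homology of the strands\<close>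

abbreviation (input) bd :: "('v::finite set \<Rightarrow> 'r::comm_ring_1) \<Rightarrow> 'v set \<Rightarrow> 'r" where
  "bd \<equiv> koszul_diff (\<lambda>_. 1)"

definition cone :: "'v::finite \<Rightarrow> ('v set \<Rightarrow> 'r::comm_ring_1) \<Rightarrow> 'v set \<Rightarrow> 'r" where
  "cone v c T = (if v \<in> T then koszul_sign v (T - {v}) * c (T - {v}) else 0)"

text \<open>Joining all faces with the vertex \<open>v\<close> is a contracting homotopy: \<open>bd \<circ> cone v + cone v \<circ> bd\<close> is the
identity. Whether the cone stays inside a given simplicial complex is the question in every
application.\<close>

lemma bd_cone:
  fixes c :: "'v::finite set \<Rightarrow> 'r::comm_ring_1"
  assumes "\<And>T. bd c T = 0"
  shows "bd (cone v c) = c"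
proof
  fix S
  show "bd (cone v c) S = c S"
  proof (cases "v \<in> S")
    case False
    have "bd (cone v c) S = (\<Sum>w\<in>- S. if w = v then c S else 0)"
      unfolding koszul_diff_def
    proof (rule sum.cong[OF refl])
      fix w assume "w \<in> - S"
      with False show "koszul_sign w S * 1 * cone v c (insert w S) = (if w = v then c S else 0)"
        by (auto simp: cone_def mult.assoc[symmetric] koszul_sign_square)
    qed
    with False show ?thesis by simp
  next
    case True
    define R where "R = S - {v}"
    have S: "S = insert v R" "v \<notin> R" using True by (auto simp: R_def)
    have mR: "- R = insert v (- S)" using S by auto
    have "bd (cone v c) S =
        (\<Sum>w\<in>- S. - (koszul_sign v R * (koszul_sign w R * c (insert w R))))"
      unfolding koszul_diff_def
    proof (rule sum.cong[OF refl])
      fix w assume w: "w \<in> - S"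
      then have ne: "insert w S - {v} = insert w R" "w \<noteq> v" "w \<notin> R" using S by auto
      have "koszul_sign w (insert v R) * koszul_sign v (insert w R) =
          - (koszul_sign v R * koszul_sign w R :: 'r)"
      proof -
        have "koszul_sign v R * koszul_sign w (insert v R) * koszul_sign v R * koszul_sign v (insert w R) =
            - (koszul_sign w R * koszul_sign v (insert w R) * koszul_sign v R * koszul_sign v (insert w R) :: 'r)"
          using koszul_sign_swap[of w v R, where 'r='r] ne S by simp
        also have "\<dots> = - (koszul_sign w R * koszul_sign v R *
            (koszul_sign v (insert w R) * koszul_sign v (insert w R)))"
          by (simp only: mult_ac)
        also have "koszul_sign v R * koszul_sign w (insert v R) * koszul_sign v R * koszul_sign v (insert w R)
          = (koszul_sign v R * koszul_sign v R) * (koszul_sign w (insert v R) * koszul_sign v (insert w R) :: 'r)"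
          by (simp only: mult_ac)
        finally show ?thesis by (simp only: koszul_sign_square) (simp add: mult_ac)
      qed
      then show "koszul_sign w S * 1 * cone v c (insert w S) =
          - (koszul_sign v R * (koszul_sign w R * c (insert w R)))"
        using S ne by (simp add: cone_def mult.assoc[symmetric])
    qed
    also have "\<dots> = - (koszul_sign v R * (\<Sum>w\<in>- S. koszul_sign w R * c (insert w R)))"
      by (simp add: sum_negf sum_distrib_left)
    also have "(\<Sum>w\<in>- S. koszul_sign w R * c (insert w R)) = bd c R - koszul_sign v R * c S"
      unfolding koszul_diff_def mR using S by simp
    also have "- (koszul_sign v R * (bd c R - koszul_sign v R * c S)) = c S"
      using assms[of R] by (simp add: mult.assoc[symmetric] koszul_sign_square)
    finally show ?thesis .
  qed
qed

definition ind :: "'v set \<Rightarrow> 'v \<Rightarrow> nat" where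
  "ind T v = (if v \<in> T then 1 else 0)"

lemma ind_le_iff: "ind T \<le> b \<longleftrightarrow> (\<forall>v\<in>T. b v > 0)"
  unfolding le_fun_def ind_def by (metis One_nat_def Suc_leI le0 not_less_eq_eq zero_less_iff_neq_zero le_zero_eq)

abbreviation unit_vec :: "'v \<Rightarrow> 'v \<Rightarrow> nat" where
  "unit_vec v \<equiv> ind {v}"

definition tdeg :: "('v::finite \<Rightarrow> nat) \<Rightarrow> nat" where
  "tdeg b = (\<Sum>v\<in>UNIV. b v)"

lemma tdeg_add: "tdeg (a + b) = tdeg a + tdeg b"
  by (simp add: tdeg_def sum.distrib)

lemma tdeg_ind: "tdeg (ind T) = card T"
  unfolding tdeg_def ind_def by (simp add: sum.If_cases)

lemma tdeg_unit_vec [simp]: "tdeg (unit_vec v) = 1"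
  by (simp add: tdeg_ind)

lemma tdeg_diff: "m \<le> b \<Longrightarrow> tdeg (b - m) = tdeg b - tdeg m"
proof -
  assume "m \<le> b"
  then have "tdeg b = tdeg (b - m) + tdeg m"
    by (simp add: tdeg_def le_fun_def flip: sum.distrib)
  then show ?thesis by simp
qed

text \<open>The upper Koszul complex of the monomial ideal \<open>U\<close> at \<open>b\<close>: its chain complex is the part of
multidegree \<open>b\<close> of the Koszul complex of that ideal.\<close>

definition in_strand :: "('v::finite \<Rightarrow> nat) set \<Rightarrow> ('v \<Rightarrow> nat) \<Rightarrow> 'v set \<Rightarrow> bool" where
  "in_strand U b T \<longleftrightarrow> ind T \<le> b \<and> b - ind T \<in> U"

text \<open>Equivalently, the multigraded Betti number \<open>\<beta>\<^sub>p\<^sub>,\<^sub>b\<close> over the field \<open>'k\<close> of the ideal vanishes.\<close>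

definition koszul_exact ::
  "'k::field itself \<Rightarrow> ('v::finite \<Rightarrow> nat) set \<Rightarrow> nat \<Rightarrow> ('v \<Rightarrow> nat) \<Rightarrow> bool" where
  "koszul_exact _ U p b \<longleftrightarrow>
     (\<forall>c :: 'v set \<Rightarrow> 'k. (\<forall>T. c T \<noteq> 0 \<longrightarrow> card T = p \<and> in_strand U b T) \<longrightarrow> (\<forall>S. bd c S = 0) \<longrightarrow>
       (\<exists>e. (\<forall>T. e T \<noteq> 0 \<longrightarrow> card T = Suc p \<and> in_strand U b T) \<and> bd e = c))"

text \<open>The inequality \<open>reg \<le> r\<close> in terms of Koszul homology. It holds for every \<open>r\<close> if \<open>U\<close> is empty, as it
should for the zero ideal.\<close>

definition reg_le :: "'k::field itself \<Rightarrow> ('v::finite \<Rightarrow> nat) set \<Rightarrow> int \<Rightarrow> bool" where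
  "reg_le k U r \<longleftrightarrow> (\<forall>p b. int (tdeg b) > int p + r \<longrightarrow> koszul_exact k U p b)"

definition up_closed :: "('v \<Rightarrow> nat) set \<Rightarrow> bool" where
  "up_closed U \<longleftrightarrow> (\<forall>a\<in>U. \<forall>b. a \<le> b \<longrightarrow> b \<in> U)"

definition multiples :: "('v \<Rightarrow> nat) set \<Rightarrow> ('v \<Rightarrow> nat) set" where
  "multiples M = {u. \<exists>m\<in>M. m \<le> u}"

definition colon :: "('v \<Rightarrow> nat) set \<Rightarrow> ('v \<Rightarrow> nat) \<Rightarrow> ('v \<Rightarrow> nat) set" where
  "colon U m = {u. u + m \<in> U}"

lemma reg_le_mono: "reg_le k U r \<Longrightarrow> r \<le> r' \<Longrightarrow> reg_le k U r'"
  unfolding reg_le_def by force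

lemma koszul_exact_coneI:
  assumes "\<And>T. card T = p \<Longrightarrow> in_strand U b T \<Longrightarrow> v \<notin> T \<Longrightarrow> in_strand U b (insert v T)"
  shows "koszul_exact (k :: 'k::field itself) U p b"
  unfolding koszul_exact_def
proof (intro allI impI)
  fix c :: "'a set \<Rightarrow> 'k"
  assume c: "\<forall>T. c T \<noteq> 0 \<longrightarrow> card T = p \<and> in_strand U b T" and z: "\<forall>S. bd c S = 0"
  have "card T = Suc p \<and> in_strand U b T" if "cone v c T \<noteq> 0" for T
  proof -
    have v: "v \<in> T" "c (T - {v}) \<noteq> 0" using that by (auto simp: cone_def split: if_splits)
    then have "card (T - {v}) = p" "in_strand U b (T - {v})" using c by auto
    with assms[of "T - {v}"] v show ?thesis
      using card_Suc_Diff1[of T v] by (auto simp: insert_absorb)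
  qed
  moreover have "bd (cone v c) = c" using z by (intro bd_cone) auto
  ultimately show "\<exists>e. (\<forall>T. e T \<noteq> 0 \<longrightarrow> card T = Suc p \<and> in_strand U b T) \<and> bd e = c" by blast
qed

lemma ind_insert_le: "v \<notin> T \<Longrightarrow> ind T \<le> b \<Longrightarrow> b v > 0 \<Longrightarrow> ind (insert v T) \<le> b"
  by (simp add: ind_le_iff)

lemma koszul_exact_UNIV:
  assumes "b v > 0"
  shows "koszul_exact k UNIV p b"
  by (rule koszul_exact_coneI[of _ _ _ v]) (use assms in \<open>auto simp: in_strand_def ind_insert_le\<close>)

lemma tdeg_pos: "tdeg b > 0 \<Longrightarrow> \<exists>v. b v > 0"
  unfolding tdeg_def by (metis gr0I less_numeral_extra(3) sum.neutral)

lemma reg_le_UNIV: "reg_le k UNIV 0"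
  unfolding reg_le_def by (metis add_0_right koszul_exact_UNIV tdeg_pos of_nat_0_le_iff of_nat_0_less_iff order.strict_trans1)

text \<open>Every strand of degree above \<open>p + 1\<close> is a cone. The apex can be any vertex outside \<open>W\<close> in the
support of \<open>b\<close>. If the support lies in \<open>W\<close>, any of its vertices will do: joining it to a face of size \<open>p\<close>
leaves a monomial of positive degree in the variables from \<open>W\<close>.\<close>

lemma reg_le_variables:
  "reg_le k {u :: 'v::finite \<Rightarrow> nat. \<exists>w\<in>W. u w > 0} 1"
  unfolding reg_le_def
proof (intro allI impI)
  fix p and b :: "'v \<Rightarrow> nat"
  assume deg: "int p + 1 < int (tdeg b)"
  let ?U = "{u :: 'v \<Rightarrow> nat. \<exists>w\<in>W. u w > 0}"
  show "koszul_exact k ?U p b"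
  proof (cases "\<exists>v. v \<notin> W \<and> b v > 0")
    case True
    then obtain v where v: "v \<notin> W" "b v > 0" by blast
    have "in_strand ?U b (insert v T)" if T: "in_strand ?U b T" "v \<notin> T" for T
    proof -
      obtain w where w: "w \<in> W" "(b - ind T) w > 0" using T by (auto simp: in_strand_def)
      with v have "(b - ind (insert v T)) w > 0" by (auto simp: ind_def)
      with w T v show ?thesis by (auto simp: in_strand_def ind_insert_le)
    qed
    then show ?thesis by (intro koszul_exact_coneI)
  next
    case False
    obtain v where v: "b v > 0" using deg tdeg_pos[of b] by auto
    have "in_strand ?U b (insert v T)" if "in_strand ?U b T" "v \<notin> T" "card T = p" for T
    proof -
      have le: "ind (insert v T) \<le> b" using that v by (auto simp: in_strand_def ind_insert_le)
      then have "tdeg (b - ind (insert v T)) > 0"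
        using deg that by (simp add: tdeg_diff tdeg_ind)
      then obtain w where w: "(b - ind (insert v T)) w > 0" using tdeg_pos by blast
      then have "w \<in> W" using False by fastforce
      with w le show ?thesis by (auto simp: in_strand_def)
    qed
    then show ?thesis by (intro koszul_exact_coneI)
  qed
qed

text \<open>This is the long exact sequence of \<open>0 \<rightarrow> S/(U : m)(-deg m) \<rightarrow> S/U \<rightarrow> S/(U + (m)) \<rightarrow> 0\<close> on the level of
chains. A cycle of \<open>U\<close> bounds a chain \<open>e\<close> of \<open>U + (m)\<close>. The part \<open>e2\<close> of \<open>e\<close> outside \<open>U\<close> lives over
multiples of \<open>m\<close>, and its boundary is a cycle of the strand of \<open>U : m\<close> at \<open>b - m\<close>. There it bounds a
chain \<open>e3\<close>, which may replace \<open>e2\<close>.\<close>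

lemma reg_le_colon_sum:
  fixes k :: "'k::field itself" and U :: "('v::finite \<Rightarrow> nat) set"
  assumes up: "up_closed U"
    and col: "reg_le k (colon U m) (r - int (tdeg m))"
    and add: "reg_le k (U \<union> multiples {m}) r"
  shows "reg_le k U r"
  unfolding reg_le_def
proof (intro allI impI)
  fix p and b :: "'v \<Rightarrow> nat" assume deg: "int p + r < int (tdeg b)"
  let ?V = "U \<union> multiples {m}"
  show "koszul_exact k U p b"
    unfolding koszul_exact_def
  proof (intro allI impI)
    fix c :: "'v set \<Rightarrow> 'k"
    assume c: "\<forall>T. c T \<noteq> 0 \<longrightarrow> card T = p \<and> in_strand U b T" and z: "\<forall>S. bd c S = 0"
    have "koszul_exact k ?V p b" using add deg by (simp add: reg_le_def)
    moreover have "\<forall>T. c T \<noteq> 0 \<longrightarrow> card T = p \<and> in_strand ?V b T"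
      using c by (auto simp: in_strand_def)
    ultimately obtain e where e: "\<And>T. e T \<noteq> 0 \<Longrightarrow> card T = Suc p \<and> in_strand ?V b T"
      and ec: "bd e = c"
      using z unfolding koszul_exact_def by metis
    \<comment> \<open>The part of \<open>e\<close> inside \<open>U\<close> and the rest.\<close>
    define e1 where "e1 T = (if in_strand U b T then e T else 0)" for T
    define e2 where "e2 T = (if in_strand U b T then 0 else e T)" for T
    have split: "e = (\<lambda>T. e1 T + e2 T)" by (auto simp: e1_def e2_def)
    have bd12: "c S = bd e1 S + bd e2 S" for S
      unfolding ec[symmetric] by (subst split) (rule koszul_diff_add)
    have e2: "card T = Suc p \<and> ind T \<le> b \<and> m \<le> b - ind T" if "e2 T \<noteq> 0" for T
      using that e[of T] by (auto simp: e2_def in_strand_def multiples_def split: if_splits)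
    have up_strand: "in_strand U b S" if "in_strand U b (insert v S)" for v S
    proof -
      have "ind S \<le> ind (insert v S)" by (auto simp: ind_def le_fun_def)
      then have "ind S \<le> b" "b - ind (insert v S) \<le> b - ind S"
        using that by (auto simp: in_strand_def le_fun_def intro: order_trans diff_le_mono2)
      with up that show ?thesis unfolding up_closed_def in_strand_def by blast
    qed
    have supp: "card S = p \<and> in_strand U b S \<and> ind S + m \<le> b" if nz: "bd e2 S \<noteq> 0" for S
    proof -
      obtain v where v: "v \<notin> S" "e2 (insert v S) \<noteq> 0" using nz by (rule koszul_diff_nonzero)
      have "ind (insert v S) + m \<le> b"
      proof (rule le_funI)
        fix x
        have "ind (insert v S) x \<le> b x" "m x \<le> b x - ind (insert v S) x"
          using e2[OF v(2)] by (auto simp: le_fun_def)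
        then show "(ind (insert v S) + m) x \<le> b x" by simp
      qed
      moreover have "ind S + m \<le> ind (insert v S) + m" by (auto simp: ind_def le_fun_def)
      ultimately have "ind S + m \<le> b" by (rule order_trans[rotated])
      moreover have "card S = p" using e2[OF v(2)] v(1) by simp
      moreover have "in_strand U b S"
      proof (cases "c S = 0")
        case True
        then have "bd e1 S \<noteq> 0" using nz bd12[of S] by auto
        then obtain w where "e1 (insert w S) \<noteq> 0" by (rule koszul_diff_nonzero)
        then show ?thesis using up_strand by (auto simp: e1_def split: if_splits)
      qed (use c in auto)
      ultimately show ?thesis by blast
    qed
    have conv: "in_strand (colon U m) (b - m) S \<longleftrightarrow> in_strand U b S \<and> ind S + m \<le> b" if "m \<le> b" for S
    proof -
      have "ind S \<le> b - m \<longleftrightarrow> ind S + m \<le> b"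
        using that by (auto simp: le_fun_def le_diff_conv2)
      moreover have "b - m - ind S + m = b - ind S" if "ind S + m \<le> b"
      proof
        fix x
        have "ind S x + m x \<le> b x" using that by (simp add: le_fun_def)
        then show "(b - m - ind S + m) x = (b - ind S) x" by simp
      qed
      moreover have "ind S \<le> b" if "ind S + m \<le> b"
        using that unfolding le_fun_def by (metis add_leD1 plus_fun_apply)
      ultimately show ?thesis by (auto simp: in_strand_def colon_def)
    qed
    have "\<exists>e3. (\<forall>T. e3 T \<noteq> 0 \<longrightarrow> card T = Suc p \<and> in_strand U b T) \<and> bd e3 = bd e2"
    proof (cases "m \<le> b")
      case True
      have "tdeg m \<le> tdeg b" using True by (auto simp: tdeg_def le_fun_def intro: sum_mono)
      then have "int p + (r - int (tdeg m)) < int (tdeg (b - m))"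
        using deg tdeg_diff[OF True] by simp
      then have "koszul_exact k (colon U m) p (b - m)"
        using col by (simp add: reg_le_def)
      moreover have "\<forall>S. bd e2 S \<noteq> 0 \<longrightarrow> card S = p \<and> in_strand (colon U m) (b - m) S"
        using supp conv[OF True] by blast
      moreover have "\<forall>S. bd (bd e2) S = 0" by (simp add: koszul_diff_diff)
      ultimately obtain e3 where "\<forall>T. e3 T \<noteq> 0 \<longrightarrow> card T = Suc p \<and> in_strand (colon U m) (b - m) T"
        "bd e3 = bd e2"
        unfolding koszul_exact_def by blast
      then show ?thesis using conv[OF True] by blast
    next
      case False
      have "e2 T = 0" for T
      proof (rule ccontr)
        assume "e2 T \<noteq> 0"
        then have "m \<le> b - ind T" using e2 by blast
        also have "\<dots> \<le> b" by (auto simp: le_fun_def)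
        finally show False using False by simp
      qed
      then have "e2 = (\<lambda>_. 0)" by auto
      then show ?thesis by (intro exI[of _ "\<lambda>_. 0"]) simp
    qed
    then obtain e3 where e3: "\<And>T. e3 T \<noteq> 0 \<Longrightarrow> card T = Suc p \<and> in_strand U b T" "bd e3 = bd e2"
      by blast
    have "bd (\<lambda>T. e1 T + e3 T) = c"
      by (rule ext) (simp add: koszul_diff_add e3(2) bd12)
    moreover have "card T = Suc p \<and> in_strand U b T" if "e1 T + e3 T \<noteq> 0" for T
      using that e3(1)[of T] e[of T] by (cases "e3 T = 0") (auto simp: e1_def split: if_splits)
    ultimately have "(\<forall>T. e1 T + e3 T \<noteq> 0 \<longrightarrow> card T = Suc p \<and> in_strand U b T) \<and>
        bd (\<lambda>T. e1 T + e3 T) = c"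
      by simp
    then show "\<exists>e. (\<forall>T. e T \<noteq> 0 \<longrightarrow> card T = Suc p \<and> in_strand U b T) \<and> bd e = c"
      by - (rule exI[of _ "\<lambda>T. e1 T + e3 T"])
  qed
qed

section \<open>Edge ideals of unions of chain graphs\<close>

text \<open>The ideal generated by the edges of \<open>E\<close> and the variables from \<open>W\<close>. The variables are carried along
because colon ideals of edge ideals by a vertex produce them.\<close>

definition graph_exponents :: "('v \<times> 'v) set \<Rightarrow> 'v set \<Rightarrow> ('v \<Rightarrow> nat) set" where
  "graph_exponents E W = {u. (\<exists>(a, b)\<in>E. u a > 0 \<and> u b > 0) \<or> (\<exists>w\<in>W. u w > 0)}"

text \<open>No two edges \<open>(a, b)\<close> and \<open>(c, d)\<close> form an induced matching; equivalently, the neighbourhoods of the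
left vertices are totally ordered by inclusion.\<close>

definition chain_rel :: "('v \<times> 'v) set \<Rightarrow> bool" where
  "chain_rel H \<longleftrightarrow> (\<forall>a b c d. (a, b) \<in> H \<longrightarrow> (c, d) \<in> H \<longrightarrow> (a, d) \<in> H \<or> (c, b) \<in> H)"

definition chain_cover :: "('v \<times> 'v) set \<Rightarrow> nat \<Rightarrow> bool" where
  "chain_cover E n \<longleftrightarrow> (\<exists>H. (\<forall>i<n. chain_rel (H i)) \<and> E = (\<Union>i<n. H i))"

lemma up_closed_graph_exponents: "up_closed (graph_exponents E W)"
  unfolding up_closed_def
proof (intro ballI allI impI)
  fix a b :: "'a \<Rightarrow> nat" assume a: "a \<in> graph_exponents E W" and "a \<le> b"
  then have "b v > 0" if "a v > 0" for v
    using that by (meson le_funD less_le_trans)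
  then show "b \<in> graph_exponents E W" using a unfolding graph_exponents_def by blast
qed

lemma multiples_unit_vec: "multiples {unit_vec x} = {u. u x > 0}"
  by (simp add: multiples_def ind_le_iff)

text \<open>Induction on \<open>n\<close>, and for fixed \<open>n\<close> on the number of vertices outside \<open>W\<close>. If the last chain graph \<open>H n\<close>
has an edge that avoids \<open>W\<close>, choose a left vertex \<open>x\<close> with the most neighbours in \<open>H n\<close> outside \<open>W\<close>. The
colon ideal by \<open>x\<close> contains all neighbours of \<open>x\<close>, so together with \<open>W\<close> a vertex of each edge of
\<open>H n\<close>, and only the other \<open>n\<close> chain graphs remain; this pays for the degree of \<open>x\<close>. Adding \<open>x\<close> to the ideal
enlarges \<open>W\<close>.\<close>

lemma reg_le_graph:
  fixes W :: "'v::finite set"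
  assumes "A \<inter> B = {}" "E \<subseteq> A \<times> B" "chain_cover E n"
  shows "reg_le k (graph_exponents E W) (int n + 1)"
  using assms(2,3)
proof (induction n arbitrary: E W)
  case 0
  then have "E = {}" by (simp add: chain_cover_def)
  then show ?case using reg_le_variables[of k W] by (simp add: graph_exponents_def)
next
  case (Suc n)
  obtain H where H: "\<And>i. i < Suc n \<Longrightarrow> chain_rel (H i)" "E = (\<Union>i<Suc n. H i)"
    using Suc.prems(2) unfolding chain_cover_def by blast
  define E' where "E' = (\<Union>i<n. H i)"
  have E: "E = E' \<union> H n" unfolding H(2) E'_def lessThan_Suc by auto
  have IH: "reg_le k (graph_exponents E' W) (int n + 1)" for W
  proof (rule Suc.IH)
    show "E' \<subseteq> A \<times> B" using Suc.prems(1) E by blast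
    show "chain_cover E' n" using H(1) unfolding chain_cover_def E'_def by (intro exI[of _ H]) auto
  qed
  show ?case
  proof (induction "card (- W)" arbitrary: W rule: less_induct)
    case less
    show ?case
    proof (cases "\<exists>(a, b)\<in>H n. a \<notin> W \<and> b \<notin> W")
      case False
      then have "graph_exponents E W = graph_exponents E' W"
        unfolding graph_exponents_def E by fast
      then show ?thesis using IH[of W] by (auto intro: reg_le_mono)
    next
      case True
      define D where "D a = {b. (a, b) \<in> H n \<and> b \<notin> W}" for a
      define C where "C = {a. a \<notin> W \<and> D a \<noteq> {}}"
      have C: "finite C" "C \<noteq> {}" using True by (auto simp: C_def D_def)
      obtain x where x: "x \<in> C" "\<And>a. a \<in> C \<Longrightarrow> card (D a) \<le> card (D x)"
      proof -
        have "Max ((\<lambda>a. card (D a)) ` C) \<in> (\<lambda>a. card (D a)) ` C"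
          using C by (intro Max_in) auto
        then obtain x where "x \<in> C" "card (D x) = Max ((\<lambda>a. card (D a)) ` C)" by force
        with C that show thesis by (metis Max_ge finite_imageI imageI)
      qed
      have xW: "x \<notin> W" and "D x \<noteq> {}" using x(1) by (auto simp: C_def)
      then have xA: "x \<in> A" using Suc.prems(1) E by (auto simp: D_def)
      then have xB: "b \<noteq> x" if "(a, b) \<in> E" for a b
        using that Suc.prems(1) assms(1) by blast
      have top: "(x, b) \<in> H n" if ab: "(a, b) \<in> H n" "a \<notin> W" "b \<notin> W" for a b
      proof (rule ccontr)
        assume nx: "(x, b) \<notin> H n"
        have "chain_rel (H n)" using H(1) by simp
        then have "D x \<subseteq> D a" using ab nx unfolding chain_rel_def D_def by blast
        moreover have "b \<in> D a" "b \<notin> D x" using ab nx by (auto simp: D_def)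
        ultimately have "D x \<subset> D a" by blast
        then have "card (D x) < card (D a)" by (intro psubset_card_mono) auto
        moreover have "a \<in> C" using ab by (auto simp: C_def D_def)
        ultimately show False using x(2)[of a] by simp
      qed
      let ?N = "{b. (x, b) \<in> E}"
      \<comment> \<open>Dividing by \<open>x\<close> turns the edges at \<open>x\<close> into variables, among them a vertex of each edge of \<open>H n\<close>.\<close>
      have "colon (graph_exponents E W) (unit_vec x) = graph_exponents E (W \<union> ?N)"
      proof -
        have val: "(u + unit_vec x) v > 0 \<longleftrightarrow> u v > 0 \<or> v = x" for u :: "'v \<Rightarrow> nat" and v
          by (simp add: ind_def)
        have "(\<exists>(a, b)\<in>E. (u a > 0 \<or> a = x) \<and> (u b > 0 \<or> b = x)) \<or> (\<exists>w\<in>W. u w > 0 \<or> w = x) \<longleftrightarrow>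
            (\<exists>(a, b)\<in>E. u a > 0 \<and> u b > 0) \<or> (\<exists>w\<in>W \<union> ?N. u w > 0)" for u :: "'v \<Rightarrow> nat"
          using xW xB by blast
        then show ?thesis unfolding colon_def graph_exponents_def mem_Collect_eq val by simp
      qed
      also have "\<dots> = graph_exponents E' (W \<union> ?N)"
      proof -
        have "a \<in> W \<or> b \<in> W \<union> ?N" if "(a, b) \<in> H n" for a b
          using top[OF that] E by blast
        then show ?thesis unfolding graph_exponents_def E by blast
      qed
      finally have "reg_le k (colon (graph_exponents E W) (unit_vec x)) (int (Suc n) + 1 - int (tdeg (unit_vec x)))"
        using IH[of "W \<union> ?N"] by (simp add: add.commute)
      moreover have "reg_le k (graph_exponents E W \<union> multiples {unit_vec x}) (int (Suc n) + 1)"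
      proof -
        have "card (- insert x W) < card (- W)"
          using xW by (intro psubset_card_mono) auto
        moreover have "graph_exponents E W \<union> multiples {unit_vec x} = graph_exponents E (insert x W)"
          unfolding multiples_unit_vec graph_exponents_def by auto
        ultimately show ?thesis using less by metis
      qed
      ultimately show ?thesis using reg_le_colon_sum up_closed_graph_exponents by blast
    qed
  qed
qed

section \<open>Sums of edges of a bipartite graph\<close>

text \<open>The exponent vectors of all products of \<open>s\<close> edges, that is, of the minimal generators of the
\<open>s\<close>-th power of the edge ideal.\<close>

primrec edge_sums :: "('v \<times> 'v) set \<Rightarrow> nat \<Rightarrow> ('v \<Rightarrow> nat) set" where
  "edge_sums E 0 = {0}"
| "edge_sums E (Suc s) = {M + unit_vec a + unit_vec b | M a b. M \<in> edge_sums E s \<and> (a, b) \<in> E}"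

lemma edge_sums_SucI:
  "M \<in> edge_sums E s \<Longrightarrow> (a, b) \<in> E \<Longrightarrow> M + unit_vec a + unit_vec b \<in> edge_sums E (Suc s)"
  by auto

lemma edge_sums_converse: "edge_sums (E\<inverse>) s = edge_sums E s"
proof -
  have "edge_sums R s \<subseteq> edge_sums (R\<inverse>) s" for R :: "('a \<times> 'a) set"
  proof (induction s)
    case (Suc s)
    show ?case
    proof
      fix N assume "N \<in> edge_sums R (Suc s)"
      then obtain M a b where "N = M + unit_vec a + unit_vec b" "M \<in> edge_sums R s" "(a, b) \<in> R"
        by auto
      with Suc edge_sums_SucI[of M "R\<inverse>" s b a] show "N \<in> edge_sums (R\<inverse>) (Suc s)"
        by (auto simp only: add_ac converse_iff)
    qed
  qed simp
  from this[of E] this[of "E\<inverse>"] show ?thesis by simp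
qed

lemma finite_edge_sums: "finite (edge_sums E s)" for E :: "('v::finite \<times> 'v) set"
proof (induction s)
  case (Suc s)
  have "edge_sums E (Suc s) = (\<lambda>(M, a, b). M + unit_vec a + unit_vec b) ` (edge_sums E s \<times> E)"
    by force
  with Suc show ?case by simp
qed simp

lemma tdeg_edge_sums: "M \<in> edge_sums E s \<Longrightarrow> tdeg M = 2 * s"
  by (induction s arbitrary: M) (auto simp: tdeg_add, simp add: tdeg_def)

declare edge_sums.simps(2) [simp del]

locale bipartition =
  fixes A B :: "'v::finite set" and E :: "('v \<times> 'v) set"
  assumes disjoint: "A \<inter> B = {}" and edges: "E \<subseteq> A \<times> B"
begin

text \<open>Statements about vertices in \<open>A\<close> transfer to vertices in \<open>B\<close> by exchanging the two sides.\<close>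

lemma flip: "bipartition B A (E\<inverse>)"
  using disjoint edges by unfold_locales auto

lemma edge_sums_remove_right:
  assumes "N \<in> edge_sums E t" "y \<in> B" "N y > 0"
  shows "\<exists>t' N' x. t = Suc t' \<and> N' \<in> edge_sums E t' \<and> (x, y) \<in> E \<and> N = N' + unit_vec x + unit_vec y"
  using assms(1,3)
proof (induction t arbitrary: N)
  case (Suc t)
  then obtain M a b where M: "N = M + unit_vec a + unit_vec b" "M \<in> edge_sums E t" "(a, b) \<in> E"
    by (auto simp: edge_sums.simps(2))
  show ?case
  proof (cases "b = y")
    case False
    have "a \<noteq> y" using M(3) edges disjoint assms(2) by auto
    with False M(1) Suc.prems(2) have "M y > 0" by (simp add: ind_def)
    then obtain t' N' x where *: "t = Suc t'" "N' \<in> edge_sums E t'" "(x, y) \<in> E"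
      "M = N' + unit_vec x + unit_vec y"
      using Suc.IH[OF M(2)] by blast
    have "N' + unit_vec a + unit_vec b \<in> edge_sums E t" using * M by (auto intro: edge_sums_SucI)
    moreover have "N = N' + unit_vec a + unit_vec b + unit_vec x + unit_vec y"
      using M(1) * by (simp add: add_ac)
    ultimately show ?thesis using * by blast
  qed (use M in blast)
qed simp

lemma edge_sums_remove_left:
  assumes "N \<in> edge_sums E t" "x \<in> A" "N x > 0"
  shows "\<exists>t' N' y. t = Suc t' \<and> N' \<in> edge_sums E t' \<and> (x, y) \<in> E \<and> N = N' + unit_vec x + unit_vec y"
proof -
  interpret flip: bipartition B A "E\<inverse>" by (rule flip)
  obtain t' N' y where *: "t = Suc t'" "N' \<in> edge_sums E t'" "(x, y) \<in> E"
      "N = N' + unit_vec y + unit_vec x"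
    using flip.edge_sums_remove_right[of N t x] assms unfolding edge_sums_converse by auto
  have "N = N' + unit_vec x + unit_vec y" unfolding *(4) by (simp only: add_ac)
  with * show ?thesis by blast
qed

text \<open>Follow an alternating path that starts with an edge \<open>iy\<close> of \<open>N\<close>. If \<open>y\<close> occurs more often in \<open>N\<close>
than in \<open>M\<close>, the path augments \<open>M\<close>. Otherwise \<open>M\<close> has an edge \<open>xy\<close>, and replacing it by \<open>iy\<close>
exchanges \<open>x\<close> for \<open>i\<close>; unless \<open>x\<close> occurs more often in \<open>M\<close> than in \<open>N\<close>, remove the two edges and
continue the path from \<open>x\<close>. Since the graph is bipartite, a path that ends in \<open>A\<close> exchanges and a path
that ends in \<open>B\<close> augments.\<close>

lemma exchange:
  assumes "M \<in> edge_sums E s" "N \<in> edge_sums E t" "i \<in> A" "M i < N i"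
  shows "(\<exists>j\<in>A. N j < M j \<and> (\<exists>M'\<in>edge_sums E s. M' + unit_vec j = M + unit_vec i)) \<or>
         (\<exists>j\<in>B. M j < N j \<and> M + unit_vec i + unit_vec j \<in> edge_sums E (Suc s))"
  using assms
proof (induction s arbitrary: M N t i rule: less_induct)
  case (less s)
  obtain t' N1 y where N1: "t = Suc t'" "N1 \<in> edge_sums E t'" "(i, y) \<in> E"
      "N = N1 + unit_vec i + unit_vec y"
    using edge_sums_remove_left[OF less.prems(2,3)] less.prems(4) by auto
  have yB: "y \<in> B" using N1(3) edges by auto
  show ?case
  proof (cases "M y < N y")
    case True
    then show ?thesis using yB edge_sums_SucI[OF less.prems(1) N1(3)] by blast
  next
    case False
    then have "M y > 0" using N1(4) by (auto simp: ind_def split: if_splits)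
    then obtain s' M1 x where M1: "s = Suc s'" "M1 \<in> edge_sums E s'" "(x, y) \<in> E"
        "M = M1 + unit_vec x + unit_vec y"
      using edge_sums_remove_right[OF less.prems(1) yB] by blast
    have xA: "x \<in> A" using M1(3) edges by auto
    have "x \<noteq> y" "i \<noteq> y" using xA yB less.prems(3) disjoint by auto
    have Miy: "M1 + unit_vec i + unit_vec y \<in> edge_sums E s"
      using M1 N1(3) by (auto intro: edge_sums_SucI)
    show ?thesis
    proof (cases "N x < M x")
      case True
      have "M1 + unit_vec i + unit_vec y + unit_vec x = M + unit_vec i"
        using M1(4) by (simp add: add_ac)
      with True Miy xA show ?thesis by blast
    next
      case False
      have "M1 x < N1 x"
        using False M1(4) N1(4) \<open>x \<noteq> y\<close> less.prems(4) by (auto simp: ind_def split: if_splits)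
      then consider j M' where "j \<in> A" "N1 j < M1 j" "M' \<in> edge_sums E s'"
            "M' + unit_vec j = M1 + unit_vec x"
        | j where "j \<in> B" "M1 j < N1 j" "M1 + unit_vec x + unit_vec j \<in> edge_sums E (Suc s')"
        using less.IH[of s' M1 N1 t' x] M1 N1 xA by blast
      then show ?thesis
      proof cases
        case 1
        have "N j < M j"
          using 1(2) M1(4) N1(4) less.prems(4) by (auto simp: ind_def split: if_splits)
        moreover have "M' + unit_vec i + unit_vec y \<in> edge_sums E s"
          using M1(1) N1(3) 1(3) by (auto intro: edge_sums_SucI)
        moreover have "M' + unit_vec i + unit_vec y + unit_vec j = M + unit_vec i"
        proof -
          have "M' + unit_vec i + unit_vec y + unit_vec j = (M' + unit_vec j) + unit_vec i + unit_vec y"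
            by (simp only: add_ac)
          also have "\<dots> = M + unit_vec i" unfolding 1(4) M1(4) by (simp only: add_ac)
          finally show ?thesis .
        qed
        ultimately show ?thesis using 1(1) by blast
      next
        case 2
        have "j \<noteq> x" "j \<noteq> i" using 2(1) xA less.prems(3) disjoint by auto
        then have "M j < N j" using 2(2) M1(4) N1(4) by (auto simp: ind_def)
        moreover have "M + unit_vec i + unit_vec j \<in> edge_sums E (Suc s)"
          using edge_sums_SucI[OF 2(3) N1(3)] unfolding M1(1,4) by (simp only: add_ac)
        ultimately show ?thesis using 2(1) by blast
      qed
    qed
  qed
qed

text \<open>If \<open>N\<close> has more edges than \<open>M\<close>, some alternating path augments \<open>M\<close>. Removing the first two edges
\<open>iy\<close> of \<open>N\<close> and \<open>xy\<close> of \<open>M\<close> of a path keeps the difference of the numbers of edges. An augmenting path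
for the remaining edges that starts at \<open>x\<close> is prolonged by these two edges; any other one augments \<open>M\<close> as it is.\<close>

lemma augment:
  assumes "M \<in> edge_sums E s" "N \<in> edge_sums E t" "s < t"
  shows "\<exists>i\<in>A. \<exists>j\<in>B. M i < N i \<and> M j < N j \<and> M + unit_vec i + unit_vec j \<in> edge_sums E (Suc s)"
  using assms
proof (induction s arbitrary: M N t rule: less_induct)
  case (less s)
  have side: "(\<Sum>a\<in>A. L a) = r" if "L \<in> edge_sums E r" for L r
    using that
  proof (induction r arbitrary: L)
    case (Suc r)
    then obtain K a b where K: "L = K + unit_vec a + unit_vec b" "K \<in> edge_sums E r" "(a, b) \<in> E"
      by (auto simp: edge_sums.simps(2))
    then have "a \<in> A" "b \<notin> A" using edges disjoint by auto
    then have "(\<Sum>c\<in>A. unit_vec a c) = 1" "(\<Sum>c\<in>A. unit_vec b c) = 0"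
      by (auto simp: ind_def)
    then show ?case using K Suc.IH[OF K(2)] by (simp add: sum.distrib)
  qed simp
  have "\<exists>i\<in>A. M i < N i"
  proof (rule ccontr)
    assume "\<not> ?thesis"
    then have "(\<Sum>a\<in>A. N a) \<le> (\<Sum>a\<in>A. M a)" by (intro sum_mono) auto
    then show False using side less.prems by simp
  qed
  then obtain i where i: "i \<in> A" "M i < N i" by blast
  obtain t' N1 y where N1: "t = Suc t'" "N1 \<in> edge_sums E t'" "(i, y) \<in> E"
      "N = N1 + unit_vec i + unit_vec y"
    using edge_sums_remove_left[OF less.prems(2) i(1)] i(2) by auto
  have yB: "y \<in> B" using N1(3) edges by auto
  show ?case
  proof (cases "M y < N y")
    case True
    then show ?thesis using i yB edge_sums_SucI[OF less.prems(1) N1(3)] by blast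
  next
    case False
    then have "M y > 0" using N1(4) by (auto simp: ind_def split: if_splits)
    then obtain s' M1 x where M1: "s = Suc s'" "M1 \<in> edge_sums E s'" "(x, y) \<in> E"
        "M = M1 + unit_vec x + unit_vec y"
      using edge_sums_remove_right[OF less.prems(1) yB] by blast
    have xA: "x \<in> A" using M1(3) edges by auto
    obtain i1 j where ij: "i1 \<in> A" "j \<in> B" "M1 i1 < N1 i1" "M1 j < N1 j"
        "M1 + unit_vec i1 + unit_vec j \<in> edge_sums E s"
    proof -
      have "s' < s" "s' < t'" using M1(1) N1(1) less.prems(3) by simp_all
      from less.IH[OF this(1) M1(2) N1(2) this(2)] that show thesis
        unfolding M1(1) by blast
    qed
    have "j \<noteq> x" "j \<noteq> i" using ij(2) xA i(1) disjoint by auto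
    then have j: "M j < N j" using ij(4) M1(4) N1(4) by (auto simp: ind_def)
    show ?thesis
    proof (cases "i1 = x")
      case True
      have "M + unit_vec i + unit_vec j \<in> edge_sums E (Suc s)"
        using edge_sums_SucI[OF ij(5) N1(3)] unfolding M1(4) True by (simp only: add_ac)
      then show ?thesis using i ij(2) j by blast
    next
      case False
      have "i1 \<noteq> y" using ij(1) yB disjoint by auto
      then have "M i1 < N i1" using False ij(3) M1(4) N1(4) by (auto simp: ind_def)
      moreover have "M + unit_vec i1 + unit_vec j \<in> edge_sums E (Suc s)"
        using edge_sums_SucI[OF ij(5) M1(3)] unfolding M1(4) by (simp only: add_ac)
      ultimately show ?thesis using ij(1,2) j by blast
    qed
  qed
qed

text \<open>The graph of the quadratic generators of \<open>I\<^sup>s\<^sup>+\<^sup>1 : M\<close>. Its edges are those of \<open>E\<close> and the pairs of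
vertices that are even-connected with respect to the edges of \<open>M\<close>.\<close>

definition link :: "nat \<Rightarrow> ('v \<Rightarrow> nat) \<Rightarrow> ('v \<times> 'v) set" where
  "link s M = {(a, b). a \<in> A \<and> b \<in> B \<and> M + unit_vec a + unit_vec b \<in> edge_sums E (Suc s)}"

lemma link_sub: "link s M \<subseteq> A \<times> B"
  by (auto simp: link_def)

lemma link_zero: "link 0 0 = E"
proof -
  have "(a, b) = (c, d)" if "a \<in> A" "b \<in> B" "(c, d) \<in> E" "unit_vec a + unit_vec b = unit_vec c + unit_vec d"
    for a b c d
  proof -
    have "c \<in> A" "d \<in> B" using that(3) edges by auto
    with that(1,2) disjoint have ne: "a \<noteq> b" "a \<noteq> d" "b \<noteq> c" by auto
    have "a = c"
      using fun_cong[OF that(4), of a] ne by (simp add: ind_def split: if_splits)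
    moreover have "b = d"
      using fun_cong[OF that(4), of b] ne by (simp add: ind_def split: if_splits)
    ultimately show ?thesis by simp
  qed
  moreover have "0 + unit_vec a + unit_vec b \<in> edge_sums E (Suc 0) \<longleftrightarrow>
      (\<exists>(c, d)\<in>E. unit_vec a + unit_vec b = unit_vec c + unit_vec d)" for a b
    by (auto simp: edge_sums.simps)
  ultimately show ?thesis using edges unfolding link_def by fast
qed

text \<open>Let \<open>N\<close> be \<open>M\<close> with both \<open>(x, y)\<close> and \<open>(u, v)\<close> added. If \<open>N\<close> is a sum of edges, then exchanging
from \<open>M\<close> towards \<open>N\<close> at \<open>u\<close> cannot remove anything, so it augments \<open>M\<close> by \<open>(u, v)\<close> or \<open>(u, y)\<close>; likewise
at \<open>v\<close>. Conversely, if \<open>u \<noteq> x\<close> and \<open>v \<noteq> y\<close>, exchange from \<open>M + (x, v)\<close> towards \<open>M + (u, y)\<close> at \<open>u\<close> either replaces \<open>x\<close> by \<open>u\<close>, which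
puts \<open>(u, v)\<close> into the link of \<open>M\<close>, or adds \<open>(u, y)\<close>, which is the claim.\<close>

lemma link_Suc:
  assumes M: "M \<in> edge_sums E s" and xy: "(x, y) \<in> E"
  shows "link (Suc s) (M + unit_vec x + unit_vec y) =
    link s M \<union> {(u, v). (u, y) \<in> link s M \<and> (x, v) \<in> link s M}"
proof -
  have xA: "x \<in> A" and yB: "y \<in> B" using xy edges by auto
  interpret flip: bipartition B A "E\<inverse>" by (rule flip)
  have "(u, v) \<in> link (Suc s) (M + unit_vec x + unit_vec y) \<longleftrightarrow>
      (u, v) \<in> link s M \<or> (u, y) \<in> link s M \<and> (x, v) \<in> link s M" (is "?L \<longleftrightarrow> ?R") for u v
  proof
    assume L: ?L
    let ?N = "M + unit_vec x + unit_vec y + unit_vec u + unit_vec v"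
    have uv: "u \<in> A" "v \<in> B" "?N \<in> edge_sums E (Suc (Suc s))"
      using L by (auto simp: link_def)
    have ne: "u \<noteq> v" "u \<noteq> y" "v \<noteq> x" using uv xA yB disjoint by auto
    have up: "M j \<le> ?N j" for j by simp
    have new: "j = x \<or> j = y \<or> j = u \<or> j = v" if "M j < ?N j" for j
      using that by (rule contrapos_pp) (simp add: ind_def)
    have "M u < ?N u" "M v < ?N v" by (simp_all add: ind_def)
    then obtain j where "j \<in> B" "M j < ?N j" "M + unit_vec u + unit_vec j \<in> edge_sums E (Suc s)"
      using exchange[OF M uv(3) uv(1)] up by (meson not_less)
    moreover from this have "j = y \<or> j = v" using new[of j] uv(1) xA disjoint by blast
    ultimately have 1: "(u, y) \<in> link s M \<or> (u, v) \<in> link s M"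
      using uv by (auto simp: link_def)
    obtain j where "j \<in> A" "M j < ?N j" "M + unit_vec v + unit_vec j \<in> edge_sums E (Suc s)"
      using flip.exchange[of M s ?N "Suc (Suc s)" v] uv M up \<open>M v < ?N v\<close>
      unfolding edge_sums_converse by (meson not_less)
    moreover from this have "j = x \<or> j = u" using new[of j] uv(2) yB disjoint by blast
    ultimately have 2: "(x, v) \<in> link s M \<or> (u, v) \<in> link s M"
      using uv by (auto simp: link_def add_ac)
    from 1 2 show ?R by blast
  next
    assume ?R
    have keep: "(u, v) \<in> link (Suc s) (M + unit_vec x + unit_vec y)" if "(u, v) \<in> link s M"
    proof -
      have "M + unit_vec u + unit_vec v + unit_vec x + unit_vec y \<in> edge_sums E (Suc (Suc s))"
        using that by (intro edge_sums_SucI[OF _ xy]) (simp add: link_def)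
      then show ?thesis using that by (auto simp: link_def add_ac)
    qed
    consider "(u, v) \<in> link s M" | "(u, y) \<in> link s M" "(x, v) \<in> link s M" "u \<noteq> x" "v \<noteq> y"
      using \<open>?R\<close> by blast
    then show ?L
    proof cases
      case 2
      let ?M = "M + unit_vec x + unit_vec v" and ?N = "M + unit_vec u + unit_vec y"
      have P: "?M \<in> edge_sums E (Suc s)" "?N \<in> edge_sums E (Suc s)" and uv: "u \<in> A" "v \<in> B"
        using 2 by (auto simp: link_def)
      then have ne: "u \<noteq> v" "x \<noteq> v" "u \<noteq> y" "x \<noteq> y" using xA yB disjoint by auto
      have lt: "?M u < ?N u" using ne 2 by (simp add: ind_def)
      consider j M' where "j \<in> A" "?N j < ?M j" "M' \<in> edge_sums E (Suc s)" "M' + unit_vec j = ?M + unit_vec u"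
        | j where "j \<in> B" "?M j < ?N j" "?M + unit_vec u + unit_vec j \<in> edge_sums E (Suc (Suc s))"
        using exchange[OF P uv(1) lt] by blast
      then show ?thesis
      proof cases
        case 1
        then have "j = x" using uv disjoint by (cases "j = x"; cases "j = v"; auto simp: ind_def)
        then have "M' + unit_vec x = M + unit_vec u + unit_vec v + unit_vec x"
          using 1(4) by (simp add: add_ac)
        then have "M' = M + unit_vec u + unit_vec v" by (rule add_right_imp_eq)
        then show ?thesis using 1(3) uv keep by (simp add: link_def)
      next
        case 2
        then have "j = y" using uv disjoint by (cases "j = y"; cases "j = u"; auto simp: ind_def)
        then show ?thesis using 2(3) uv by (simp add: link_def add_ac)
      qed
    qed (rule keep)
  qed
  then show ?thesis by auto
qed

end

text \<open>Every chain graph \<open>H i\<close> absorbs the new edges that arise with one of the two old edges in \<open>H i\<close>; each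
new edge arises in this way for some \<open>i\<close>. The enlarged neighbourhoods remain nested: a vertex
adjacent to \<open>y\<close> in \<open>H i\<close> gains all neighbours of \<open>x\<close> in \<open>E\<close>, and one adjacent to \<open>y\<close> in \<open>E\<close> gains the
neighbours of \<open>x\<close> in \<open>H i\<close>.\<close>

lemma chain_cover_step:
  assumes "chain_cover E n"
  shows "chain_cover (E \<union> {(u, v). (u, y) \<in> E \<and> (x, v) \<in> E}) n"
proof -
  obtain H where H: "\<And>i. i < n \<Longrightarrow> chain_rel (H i)" "E = (\<Union>i<n. H i)"
    using assms unfolding chain_cover_def by blast
  define H' where "H' i = H i \<union> {(u, v). (u, y) \<in> E \<and> (x, v) \<in> H i} \<union> {(u, v). (u, y) \<in> H i \<and> (x, v) \<in> E}" for i
  have "chain_rel (H' i)" if i: "i < n" for i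
  proof -
    have sub: "(a, b) \<in> E" if "(a, b) \<in> H i" for a b using that H(2) i by blast
    have ch: "(a, d) \<in> H i \<or> (c, b) \<in> H i" if "(a, b) \<in> H i" "(c, d) \<in> H i" for a b c d
      using that H(1)[OF i] unfolding chain_rel_def by blast
    show ?thesis
      unfolding chain_rel_def
    proof (intro allI impI)
      fix a b c d
      assume "(a, b) \<in> H' i" "(c, d) \<in> H' i"
      then show "(a, d) \<in> H' i \<or> (c, b) \<in> H' i"
        unfolding H'_def using sub ch[of a b c d] ch[of a b x d] ch[of a b c y] ch[of c d x b] ch[of c d a y]
        by blast
    qed
  qed
  moreover have "E \<union> {(u, v). (u, y) \<in> E \<and> (x, v) \<in> E} = (\<Union>i<n. H' i)"
    unfolding H'_def H(2) by blast
  ultimately show ?thesis unfolding chain_cover_def by blast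
qed

definition lex_less :: "('v::finite \<Rightarrow> nat) \<Rightarrow> ('v \<Rightarrow> nat) \<Rightarrow> bool" where
  "lex_less M N \<longleftrightarrow> (\<exists>i. M i < N i \<and> (\<forall>k. to_nat k < to_nat i \<longrightarrow> M k = N k))"

lemma lex_less_linear:
  assumes "M \<noteq> N"
  shows "lex_less M N \<or> lex_less N M"
proof -
  obtain j where "M j \<noteq> N j" using assms by auto
  then obtain i where i: "M i \<noteq> N i" "\<And>k. to_nat k < to_nat i \<Longrightarrow> M k = N k"
    using ex_has_least_nat[of "\<lambda>i. M i \<noteq> N i" j to_nat] by (metis leD)
  then show ?thesis unfolding lex_less_def by (metis linorder_neqE_nat)
qed

lemma lex_less_trans: "lex_less L M \<Longrightarrow> lex_less M N \<Longrightarrow> lex_less L N"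
proof -
  assume "lex_less L M" "lex_less M N"
  then obtain i j where i: "L i < M i" "\<And>k. to_nat k < to_nat i \<Longrightarrow> L k = M k"
    and j: "M j < N j" "\<And>k. to_nat k < to_nat j \<Longrightarrow> M k = N k"
    unfolding lex_less_def by metis
  show ?thesis
  proof (cases "to_nat i" "to_nat j" rule: linorder_cases)
    case less
    then show ?thesis using i j unfolding lex_less_def by (metis order.strict_trans)
  next
    case equal
    then have "i = j" by simp
    then show ?thesis using i j unfolding lex_less_def by (metis order.strict_trans)
  next
    case greater
    then show ?thesis using i j unfolding lex_less_def by (metis order.strict_trans)
  qed
qed

lemma lex_less_irrefl: "\<not> lex_less M M"
  by (simp add: lex_less_def)

lemma up_closed_multiples: "up_closed (multiples M)"
  unfolding up_closed_def multiples_def by (auto intro: order_trans)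

lemma up_closed_Un: "up_closed U \<Longrightarrow> up_closed V \<Longrightarrow> up_closed (U \<union> V)"
  unfolding up_closed_def by blast

context bipartition
begin

lemma chain_cover_link:
  assumes "chain_cover E n" "M \<in> edge_sums E s"
  shows "chain_cover (link s M) n"
  using assms(2)
proof (induction s arbitrary: M)
  case 0
  then show ?case using assms(1) by (simp only: edge_sums.simps singleton_iff link_zero)
next
  case (Suc s)
  then obtain K x y where K: "M = K + unit_vec x + unit_vec y" "K \<in> edge_sums E s" "(x, y) \<in> E"
    by (auto simp: edge_sums.simps(2))
  show ?case
    unfolding K(1) link_Suc[OF K(2,3)] by (rule chain_cover_step[OF Suc.IH[OF K(2)]])
qed

text \<open>Let \<open>N \<le> u + M\<close>. If \<open>N\<close> is a sum of \<open>s + 1\<close> edges, augmenting \<open>M\<close> yields an edge of the link that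
divides \<open>u\<close>. If \<open>N \<in> Q\<close>, apply exchange at the first vertex \<open>i\<close> where the two vectors differ:
augmenting yields an edge of the link again, and exchanging \<open>i\<close> for some \<open>j\<close>, which necessarily comes
later, yields a lexicographically larger sum of \<open>s\<close> edges that divides \<open>M x\<^sub>i\<close>, so the variable \<open>x\<^sub>i\<close>
lies in the colon ideal.\<close>

lemma colon_lex_segment:
  assumes M: "M \<in> edge_sums E s" and Q: "Q \<subseteq> edge_sums E s"
    and above: "\<And>N. N \<in> Q \<Longrightarrow> lex_less M N"
    and all: "\<And>N. N \<in> edge_sums E s \<Longrightarrow> lex_less M N \<Longrightarrow> N \<in> Q"
  shows "colon (multiples (edge_sums E (Suc s)) \<union> multiples Q) M =
    graph_exponents (link s M) {v. \<exists>N\<in>Q. N \<le> M + unit_vec v}" (is "?L = graph_exponents _ ?W")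
proof (rule Set.set_eqI, rule iffI)
  fix u assume "u \<in> ?L"
  then consider N where "N \<in> edge_sums E (Suc s)" "N \<le> u + M" | N where "N \<in> Q" "N \<le> u + M"
    by (auto simp: colon_def multiples_def)
  then show "u \<in> graph_exponents (link s M) ?W"
  proof cases
    case 1
    have pos: "u i > 0" if "M i < N i" for i
      using that le_funD[OF 1(2), of i] by simp
    from augment[OF M 1(1)] obtain i j where "i \<in> A" "j \<in> B" "M i < N i" "M j < N j"
      "M + unit_vec i + unit_vec j \<in> edge_sums E (Suc s)" by auto
    then show ?thesis using pos by (auto simp: graph_exponents_def link_def)
  next
    case 2
    have pos: "u i > 0" if "M i < N i" for i
      using that le_funD[OF 2(2), of i] by simp
    have NE: "N \<in> edge_sums E s" using 2 Q by blast
    obtain i where i: "M i < N i" "\<And>k. to_nat k < to_nat i \<Longrightarrow> M k = N k"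
      using above[OF 2(1)] unfolding lex_less_def by blast
    have shift: "u \<in> graph_exponents (link s M) ?W"
      if j: "N j < M j" "M' \<in> edge_sums E s" "M' + unit_vec j = M + unit_vec i" for j M'
    proof -
      have ij: "i \<noteq> j" using i(1) j(1) by auto
      have "\<not> to_nat j < to_nat i" using i(2) j(1) by force
      then have later: "to_nat i < to_nat j" using ij by (metis injD inj_to_nat linorder_neqE_nat)
      have M': "M' k + unit_vec j k = M k + unit_vec i k" for k
        using fun_cong[OF j(3), of k] by simp
      have "M i < M' i" using M'[of i] ij by (simp add: ind_def)
      moreover have "M k = M' k" if "to_nat k < to_nat i" for k
        using M'[of k] that later by (auto simp: ind_def split: if_splits)
      ultimately have "lex_less M M'" unfolding lex_less_def by blast
      then have "M' \<in> Q" using all j(2) by blast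
      moreover have "M' \<le> M + unit_vec i" unfolding j(3)[symmetric] by (simp add: le_fun_def)
      ultimately have "i \<in> ?W" by blast
      then show ?thesis using pos[OF i(1)] by (auto simp: graph_exponents_def)
    qed
    have "i \<in> A \<union> B"
    proof (rule ccontr)
      assume "i \<notin> A \<union> B"
      have "L i = 0" if "L \<in> edge_sums E r" for L r
        using that
      proof (induction r arbitrary: L)
        case (Suc r)
        then obtain K a b where K: "L = K + unit_vec a + unit_vec b" "K \<in> edge_sums E r" "(a, b) \<in> E"
          by (auto simp: edge_sums.simps(2))
        then have "a \<noteq> i" "b \<noteq> i" using edges \<open>i \<notin> A \<union> B\<close> by auto
        then show ?case using K Suc.IH[OF K(2)] by (simp add: ind_def)
      qed simp
      from this[OF NE] show False using i(1) by simp
    qed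
    then show ?thesis
    proof
      assume "i \<in> A"
      then consider j M' where "N j < M j" "M' \<in> edge_sums E s" "M' + unit_vec j = M + unit_vec i"
        | j where "j \<in> B" "M j < N j" "M + unit_vec i + unit_vec j \<in> edge_sums E (Suc s)"
        using exchange[OF M NE \<open>i \<in> A\<close> i(1)] by blast
      then show ?thesis
      proof cases
        case 2
        then show ?thesis using pos i(1) \<open>i \<in> A\<close> by (auto simp: graph_exponents_def link_def)
      qed (rule shift)
    next
      interpret flip: bipartition B A "E\<inverse>" by (rule flip)
      assume "i \<in> B"
      then consider j M' where "N j < M j" "M' \<in> edge_sums E s" "M' + unit_vec j = M + unit_vec i"
        | j where "j \<in> A" "M j < N j" "M + unit_vec i + unit_vec j \<in> edge_sums E (Suc s)"
        using flip.exchange[of M s N s i] M NE i(1) unfolding edge_sums_converse by blast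
      then show ?thesis
      proof cases
        case 2
        then have "(j, i) \<in> link s M" using \<open>i \<in> B\<close> by (simp add: link_def add_ac)
        then show ?thesis using pos i(1) 2(2) by (auto simp: graph_exponents_def)
      qed (rule shift)
    qed
  qed
next
  fix u assume "u \<in> graph_exponents (link s M) ?W"
  then consider a b where "(a, b) \<in> link s M" "u a > 0" "u b > 0"
    | v N where "N \<in> Q" "N \<le> M + unit_vec v" "u v > 0"
    by (auto simp: graph_exponents_def)
  then show "u \<in> ?L"
  proof cases
    case 1
    then have "a \<noteq> b" using disjoint by (auto simp: link_def)
    with 1 have "M + unit_vec a + unit_vec b \<le> u + M"
      by (auto simp: le_fun_def ind_def)
    then show ?thesis using 1(1) by (auto simp: colon_def multiples_def link_def)
  next
    case 2
    have "M + unit_vec v \<le> u + M" using 2(3) by (auto simp: le_fun_def ind_def)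
    with 2 have "N \<le> u + M" by (meson order_trans)
    then show ?thesis using 2(1) by (auto simp: colon_def multiples_def)
  qed
qed

text \<open>Starting from the \<open>s\<close>-th power, in which all sums \<open>M\<close> of \<open>s\<close> edges are generators, remove them one at
a time in ascending lexicographic order; each time the colon ideal has regularity at most \<open>n + 1\<close>
and \<open>M\<close> has degree \<open>2 s\<close>.\<close>

lemma reg_le_edge_sums_Suc:
  assumes cover: "chain_cover E n"
    and prev: "reg_le k (multiples (edge_sums E s)) r"
    and r: "2 * int s + int n + 1 \<le> r"
  shows "reg_le k (multiples (edge_sums E (Suc s))) r"
proof -
  let ?P = "edge_sums E s" and ?J = "multiples (edge_sums E (Suc s))"
  have "reg_le k (?J \<union> multiples Q) r"
    if "Q \<subseteq> ?P" "\<And>M N. M \<in> Q \<Longrightarrow> N \<in> ?P \<Longrightarrow> lex_less M N \<Longrightarrow> N \<in> Q" for Q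
    using that
  proof (induction "card (?P - Q)" arbitrary: Q rule: less_induct)
    case less
    show ?case
    proof (cases "Q = ?P")
      case True
      have "?J \<subseteq> multiples ?P"
      proof -
        have "\<exists>M\<in>?P. M \<le> u" if "N \<in> edge_sums E (Suc s)" "N \<le> u" for N u
        proof -
          obtain M a b where "N = M + unit_vec a + unit_vec b" "M \<in> ?P"
            using \<open>N \<in> edge_sums E (Suc s)\<close> by (auto simp: edge_sums.simps(2))
          moreover have "M \<le> M + unit_vec a + unit_vec b" by (simp add: le_fun_def)
          ultimately show ?thesis using \<open>N \<le> u\<close> by (metis order_trans)
        qed
        then show ?thesis by (auto simp: multiples_def)
      qed
      with True prev show ?thesis by (simp add: Un_absorb1)
    next
      case False
      have "\<exists>M\<in>?P - Q. \<forall>x\<in>?P - Q. x \<noteq> M \<longrightarrow> \<not> lex_less M x"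
      proof (rule Finite_Set.bex_max_element)
        show "finite (?P - Q)" by (simp add: finite_edge_sums)
        show "?P - Q \<noteq> {}" using False less.prems(1) by blast
        show "transp_on (?P - Q) lex_less" by (rule transp_onI) (rule lex_less_trans)
        show "asymp_on (?P - Q) lex_less" by (rule asymp_onI) (meson lex_less_irrefl lex_less_trans)
      qed
      then obtain M where M: "M \<in> ?P" "M \<notin> Q" "\<And>N. N \<in> ?P \<Longrightarrow> N \<notin> Q \<Longrightarrow> N \<noteq> M \<Longrightarrow> \<not> lex_less M N"
        by blast
      have all: "N \<in> Q" if "N \<in> ?P" "lex_less M N" for N
        using M(3)[OF that(1)] that(2) lex_less_irrefl by blast
      have above: "lex_less M N" if "N \<in> Q" for N
        using lex_less_linear[of M N] that M(1,2) less.prems(2)[of N M] by blast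
      have colon: "colon (?J \<union> multiples Q) M = graph_exponents (link s M) {v. \<exists>N\<in>Q. N \<le> M + unit_vec v}"
        by (rule colon_lex_segment[OF M(1) less.prems(1) above all])
      have "int n + 1 \<le> r - int (tdeg M)" using r tdeg_edge_sums[OF M(1)] by simp
      with reg_le_graph[OF disjoint link_sub chain_cover_link[OF cover M(1)]]
      have "reg_le k (colon (?J \<union> multiples Q) M) (r - int (tdeg M))"
        unfolding colon by (rule reg_le_mono)
      moreover have "reg_le k (?J \<union> multiples (insert M Q)) r"
      proof (rule less.hyps)
        show "card (?P - insert M Q) < card (?P - Q)"
          using M by (intro psubset_card_mono) (auto simp: finite_edge_sums)
        show "insert M Q \<subseteq> ?P" using M(1) less.prems(1) by blast
        show "N' \<in> insert M Q" if "N \<in> insert M Q" "N' \<in> ?P" "lex_less N N'" for N N'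
          using that all less.prems(2) by blast
      qed
      moreover have "?J \<union> multiples (insert M Q) = ?J \<union> multiples Q \<union> multiples {M}"
        by (auto simp: multiples_def)
      ultimately show ?thesis
        by (intro reg_le_colon_sum[of "?J \<union> multiples Q" k M] up_closed_Un up_closed_multiples) simp_all
    qed
  qed
  from this[of "{}"] show ?thesis by (simp add: multiples_def)
qed

theorem reg_le_edge_sums:
  assumes "chain_cover E n" "s \<ge> 1"
  shows "reg_le k (multiples (edge_sums E s)) (2 * int s + int n - 1)"
  using assms(2)
proof (induction s rule: dec_induct)
  case base
  \<comment> \<open>The zeroth power is the unit ideal, of regularity \<open>0 \<le> n + 1\<close>.\<close>
  have "multiples (edge_sums E 0) = UNIV" by (auto simp: multiples_def le_fun_def)
  then have "reg_le k (multiples (edge_sums E 0)) (int n + 1)"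
    using reg_le_UNIV[of k] by (auto intro: reg_le_mono)
  from reg_le_edge_sums_Suc[OF assms(1) this] show ?case by (simp add: add.commute)
next
  case (step s)
  have "reg_le k (multiples (edge_sums E s)) (2 * int s + int n + 1)"
    using step.IH by (rule reg_le_mono) simp
  from reg_le_edge_sums_Suc[OF assms(1) this] show ?case by (simp add: algebra_simps)
qed

end

section \<open>Coefficients and homogeneous polynomials\<close>

text \<open>Coefficients are indexed by plain functions, on which the pointwise order is divisibility of
monomials.\<close>

definition coef :: "('v::finite, 'k::zero) mpoly \<Rightarrow> ('v \<Rightarrow> nat) \<Rightarrow> 'k" where
  "coef p b = Poly_Mapping.lookup p (Abs_poly_mapping b)"

lemma lookup_Abs [simp]: "Poly_Mapping.lookup (Abs_poly_mapping b) = b" for b :: "'v::finite \<Rightarrow> nat"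
  by (rule lookup_Abs_poly_mapping) simp

lemma Abs_lookup [simp]: "Abs_poly_mapping (Poly_Mapping.lookup m) = m"
  by (rule poly_mapping_eqI) simp

lemma coef_lookup: "coef p (Poly_Mapping.lookup m) = Poly_Mapping.lookup p m"
  by (simp add: coef_def)

lemma coef_eqI: "(\<And>b. coef p b = coef q b) \<Longrightarrow> p = q"
  by (rule poly_mapping_eqI) (metis coef_lookup)

lemma coef_zero [simp]: "coef 0 b = 0"
  by (simp add: coef_def)

lemma coef_add: "coef (p + q) b = coef p b + coef q b"
  by (simp add: coef_def lookup_add)

lemma coef_minus: "coef (p - q) b = coef p b - coef q b"
  by (simp add: coef_def lookup_minus)

lemma coef_uminus: "coef (- p) b = - coef p b"
  by (simp add: coef_def)

lemma coef_sum: "coef (sum f A) b = (\<Sum>x\<in>A. coef (f x) b)"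
  by (simp add: coef_def lookup_sum)

lemma coef_single_mult_add:
  "coef (Poly_Mapping.single k c * p) (Poly_Mapping.lookup k + b) = c * coef p b"
  for c :: "'k::comm_ring_1"
proof -
  have sum: "Abs_poly_mapping (Poly_Mapping.lookup k + b) = k + Abs_poly_mapping b"
    by (rule poly_mapping_eqI) (simp add: lookup_add)
  show ?thesis
    unfolding coef_def sum lookup_mult lookup_single by (simp add: when_mult)
qed

lemma coef_single_mult_zero:
  "\<not> Poly_Mapping.lookup k \<le> b \<Longrightarrow> coef (Poly_Mapping.single k c * p) b = 0"
  for c :: "'k::comm_ring_1"
proof -
  assume le: "\<not> Poly_Mapping.lookup k \<le> b"
  have ne: "Abs_poly_mapping b \<noteq> k + q" for q
  proof
    assume eq: "Abs_poly_mapping b = k + q"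
    have "b x = Poly_Mapping.lookup k x + Poly_Mapping.lookup q x" for x
      using arg_cong[OF eq, of "\<lambda>m. Poly_Mapping.lookup m x"] by (simp add: lookup_add)
    then show False using le by (simp add: le_fun_def)
  qed
  show ?thesis
    unfolding coef_def lookup_mult lookup_single by (simp add: when_mult ne)
qed

lemma coef_X_mult: "coef (X v * p) b = (if b v > 0 then coef p (b - unit_vec v) else 0)"
proof -
  have single: "Poly_Mapping.lookup (Poly_Mapping.single v 1) = unit_vec v"
    by (auto simp: lookup_single ind_def when_def)
  show ?thesis
  proof (cases "b v > 0")
    case True
    then have "b = unit_vec v + (b - unit_vec v)" by (auto simp: ind_def fun_eq_iff)
    with True show ?thesis
      using coef_single_mult_add[of "Poly_Mapping.single v 1" 1 p "b - unit_vec v"]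
      unfolding single X_def by simp
  next
    case False
    then show ?thesis
      using coef_single_mult_zero[of "Poly_Mapping.single v 1" b 1 p]
      unfolding single X_def by (simp add: ind_le_iff)
  qed
qed

text \<open>A monomial of a product is a product of monomials of the factors.\<close>

lemma coef_mult_nonzero:
  fixes p q :: "('v::finite, 'k::comm_ring_1) mpoly"
  assumes "coef (p * q) b \<noteq> 0"
  shows "\<exists>k l. b = k + l \<and> coef p k \<noteq> 0 \<and> coef q l \<noteq> 0"
proof -
  have "Abs_poly_mapping b \<in> Poly_Mapping.keys (p * q)"
    using assms by (simp add: coef_def in_keys_iff)
  then obtain k l where kl: "Abs_poly_mapping b = k + l"
      "k \<in> Poly_Mapping.keys p" "l \<in> Poly_Mapping.keys q"
    using keys_mult[of p q] by blast
  have "b = Poly_Mapping.lookup k + Poly_Mapping.lookup l"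
    using arg_cong[OF kl(1), of Poly_Mapping.lookup] by (simp add: lookup_add fun_eq_iff)
  then show ?thesis using kl(2,3) by (auto simp: in_keys_iff simp flip: coef_lookup)
qed

lemma mdeg_tdeg: "mdeg m = tdeg (Poly_Mapping.lookup m)"
  unfolding mdeg_def tdeg_def
  by (rule sum.mono_neutral_left) (auto simp: in_keys_iff)

lemma homogeneous_coef: "homogeneous d p \<longleftrightarrow> (\<forall>b. coef p b \<noteq> 0 \<longrightarrow> int (tdeg b) = d)"
proof
  assume "homogeneous d p"
  then show "\<forall>b. coef p b \<noteq> 0 \<longrightarrow> int (tdeg b) = d"
    unfolding homogeneous_def mdeg_tdeg coef_def by (metis in_keys_iff lookup_Abs)
next
  assume "\<forall>b. coef p b \<noteq> 0 \<longrightarrow> int (tdeg b) = d"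
  then show "homogeneous d p"
    by (auto simp: homogeneous_def in_keys_iff mdeg_tdeg simp flip: coef_lookup)
qed

lemma homogeneous_zero [simp]: "homogeneous d 0"
  by (simp add: homogeneous_def)

lemma homogeneous_sum:
  fixes f :: "'i \<Rightarrow> ('v::finite, 'k::comm_ring_1) mpoly"
  shows
  "(\<And>x. x \<in> A \<Longrightarrow> homogeneous d (f x)) \<Longrightarrow> homogeneous d (sum f A)"
  unfolding homogeneous_coef coef_sum by (auto elim!: sum.not_neutral_contains_not_neutral)

lemma homogeneous_mult:
  fixes p q :: "('v::finite, 'k::comm_ring_1) mpoly"
  assumes "homogeneous d p" "homogeneous e q"
  shows "homogeneous (d + e) (p * q)"
  unfolding homogeneous_coef
proof (intro allI impI)
  fix b assume "coef (p * q) b \<noteq> 0"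
  then obtain k l where "b = k + l" "coef p k \<noteq> 0" "coef q l \<noteq> 0"
    using coef_mult_nonzero by blast
  then show "int (tdeg b) = d + e" using assms by (simp add: homogeneous_coef tdeg_add)
qed

definition mon_ideal :: "('v::finite \<Rightarrow> nat) set \<Rightarrow> ('v, 'k::zero) mpoly set" where
  "mon_ideal U = {p. \<forall>b. coef p b \<noteq> 0 \<longrightarrow> b \<in> U}"

section \<open>Polynomial Koszul chains and their strands\<close>

text \<open>Polynomial chains are encoded by their multigraded components: the coefficient of \<open>x\<^sup>u\<close> at the face \<open>T\<close>
belongs to the multidegree \<open>u + ind T\<close>.\<close>

definition strand ::
  "('v::finite set \<Rightarrow> ('v, 'k::comm_ring_1) mpoly) \<Rightarrow> ('v \<Rightarrow> nat) \<Rightarrow> 'v set \<Rightarrow> 'k" where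
  "strand c b T = (if ind T \<le> b then coef (c T) (b - ind T) else 0)"

lemma coef_koszul_sign_mult:
  "coef (koszul_sign v S * p) b = koszul_sign v S * coef p b"
  by (simp add: koszul_sign_def minus_one_power_iff coef_uminus)

lemma strand_koszul_diff:
  fixes c :: "'v::finite set \<Rightarrow> ('v, 'k::comm_ring_1) mpoly"
  shows "strand (koszul_diff X c) b S = bd (strand c b) S"
proof (cases "ind S \<le> b")
  case True
  have "coef (X v * c (insert v S)) (b - ind S) = strand c b (insert v S)" if "v \<in> - S" for v
  proof -
    have "(b - ind S) v > 0 \<longleftrightarrow> ind (insert v S) \<le> b"
      using True that by (auto simp: ind_le_iff ind_def)
    moreover have "b - ind S - unit_vec v = b - ind (insert v S)"
      using that by (auto simp: fun_eq_iff ind_def)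
    ultimately show ?thesis by (simp add: coef_X_mult strand_def)
  qed
  then show ?thesis
    using True by (simp add: strand_def koszul_diff_def coef_sum coef_koszul_sign_mult mult.assoc)
next
  case False
  then have "\<not> ind (insert v S) \<le> b" for v by (auto simp: ind_le_iff)
  with False show ?thesis by (simp add: strand_def koszul_diff_def)
qed

lemma coef_strand: "coef (c T) b = strand c (b + ind T) T"
proof -
  have "ind T \<le> b + ind T" "b + ind T - ind T = b" by (auto simp: le_fun_def fun_eq_iff)
  then show ?thesis by (simp add: strand_def)
qed

lemma strand_eqI: "(\<And>b. strand c b = strand e b) \<Longrightarrow> c = e"
  by (intro ext coef_eqI) (simp add: coef_strand)

text \<open>A homogeneous polynomial cycle splits into finitely many strands, each of which bounds by
assumption; the bounding chains are assembled into a polynomial chain.\<close>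

lemma koszul_cycle_lift:
  fixes c :: "'v::finite set \<Rightarrow> ('v, 'k::field) mpoly"
  assumes exact: "\<And>b. int (tdeg b) = d \<Longrightarrow> koszul_exact TYPE('k) U p b"
    and card: "\<And>T. c T \<noteq> 0 \<Longrightarrow> card T = p"
    and mem: "\<And>T. c T \<in> mon_ideal U"
    and hom: "\<And>T. homogeneous (d - int p) (c T)"
    and cycle: "\<And>S. koszul_diff X c S = 0"
  shows "\<exists>e. (\<forall>T. e T \<noteq> 0 \<longrightarrow> card T = Suc p) \<and> (\<forall>T. e T \<in> mon_ideal U) \<and>
    (\<forall>T. homogeneous (d - int (Suc p)) (e T)) \<and> koszul_diff X e = c"
proof -
  have supp: "card T = p \<and> in_strand U b T \<and> int (tdeg b) = d" if "strand c b T \<noteq> 0" for b T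
  proof -
    have nz: "ind T \<le> b" "coef (c T) (b - ind T) \<noteq> 0"
      using that by (auto simp: strand_def split: if_splits)
    then have "card T = p" using card by force
    moreover have "b - ind T \<in> U" using mem nz by (auto simp: mon_ideal_def)
    moreover have "int (tdeg (b - ind T)) = d - int p"
      using hom nz by (auto simp: homogeneous_coef)
    moreover have "tdeg b = tdeg (b - ind T) + tdeg (ind T)"
    proof -
      have "b = (b - ind T) + ind T" using nz(1) by (auto simp: le_fun_def fun_eq_iff)
      then show ?thesis by (metis tdeg_add)
    qed
    ultimately show ?thesis using nz(1) by (simp add: in_strand_def tdeg_ind)
  qed
  define Q where "Q b e \<longleftrightarrow> (\<forall>T. e T \<noteq> 0 \<longrightarrow> card T = Suc p \<and> in_strand U b T) \<and> bd e = strand c b \<and>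
      (strand c b = (\<lambda>_. 0) \<longrightarrow> e = (\<lambda>_. 0)) \<and> (\<forall>T. e T \<noteq> 0 \<longrightarrow> int (tdeg b) = d)" for b e
  have "\<exists>e. Q b e" for b
  proof (cases "strand c b = (\<lambda>_. 0)")
    case True
    then show ?thesis unfolding Q_def by (intro exI[of _ "\<lambda>_. 0"]) auto
  next
    case False
    then have d: "int (tdeg b) = d" using supp by fastforce
    have "bd (strand c b) S = 0" for S
    proof -
      have "koszul_diff X c = (\<lambda>_. 0)" using cycle by auto
      then show ?thesis using strand_koszul_diff[of c b S] by (simp add: strand_def split: if_splits)
    qed
    then obtain e where "\<forall>T. e T \<noteq> 0 \<longrightarrow> card T = Suc p \<and> in_strand U b T" "bd e = strand c b"
      using exact[OF d, unfolded koszul_exact_def, THEN spec[of _ "strand c b"]] supp by blast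
    then show ?thesis unfolding Q_def using d False by (intro exI[of _ e]) simp
  qed
  then obtain \<delta> where "\<And>b. Q b (\<delta> b)" by metis
  then have \<delta>: "\<And>b T. \<delta> b T \<noteq> 0 \<Longrightarrow> card T = Suc p \<and> in_strand U b T"
    "\<And>b. bd (\<delta> b) = strand c b" "\<And>b. strand c b = (\<lambda>_. 0) \<Longrightarrow> \<delta> b = (\<lambda>_. 0)"
    "\<And>b T. \<delta> b T \<noteq> 0 \<Longrightarrow> int (tdeg b) = d"
    unfolding Q_def by blast+
  have fin: "finite {b. strand c b \<noteq> (\<lambda>_. 0)}"
  proof (rule finite_subset)
    show "{b. strand c b \<noteq> (\<lambda>_. 0)} \<subseteq>
        (\<Union>T. (\<lambda>m. Poly_Mapping.lookup m + ind T) ` Poly_Mapping.keys (c T))"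
    proof
      fix b assume "b \<in> {b. strand c b \<noteq> (\<lambda>_. 0)}"
      then obtain T where T: "ind T \<le> b" "coef (c T) (b - ind T) \<noteq> 0"
        by (auto simp: strand_def fun_eq_iff split: if_splits)
      then have "Abs_poly_mapping (b - ind T) \<in> Poly_Mapping.keys (c T)"
        by (simp add: coef_def in_keys_iff)
      moreover have "b = Poly_Mapping.lookup (Abs_poly_mapping (b - ind T)) + ind T"
        using T(1) by (auto simp: le_fun_def fun_eq_iff)
      ultimately show "b \<in> (\<Union>T. (\<lambda>m. Poly_Mapping.lookup m + ind T) ` Poly_Mapping.keys (c T))"
        by blast
    qed
  qed simp
  \<comment> \<open>Only finitely many strands of \<open>c\<close> are nonzero, and \<open>\<delta>\<close> is zero on the others, so the \<open>\<delta> b\<close> are the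
    strands of a chain of polynomials.\<close>
  define e where "e T = Abs_poly_mapping (\<lambda>m. \<delta> (Poly_Mapping.lookup m + ind T) T)" for T
  have coef_e: "coef (e T) b = \<delta> (b + ind T) T" for T b
  proof -
    have "finite ((\<lambda>m. Poly_Mapping.lookup m + ind T) -` {b. strand c b \<noteq> (\<lambda>_. 0)})"
      by (rule finite_vimageI[OF fin]) (auto intro!: injI poly_mapping_eqI dest: fun_cong)
    then have "finite {m. \<delta> (Poly_Mapping.lookup m + ind T) T \<noteq> 0}"
      by (rule rev_finite_subset) (auto dest: \<delta>(3))
    then show ?thesis unfolding coef_def e_def by (simp add: lookup_Abs_poly_mapping)
  qed
  have strand_e: "strand e b = \<delta> b" for b
  proof
    fix T
    have "b - ind T + ind T = b" if "ind T \<le> b"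
      using that by (auto simp: le_fun_def fun_eq_iff)
    moreover have "\<delta> b T = 0" if "\<not> ind T \<le> b" using \<delta>(1)[of b T] that by (auto simp: in_strand_def)
    ultimately show "strand e b T = \<delta> b T" by (simp add: strand_def coef_e)
  qed
  have "koszul_diff X e = c"
    by (rule strand_eqI) (simp add: fun_eq_iff strand_koszul_diff strand_e \<delta>(2))
  moreover have "card T = Suc p" if nz: "e T \<noteq> 0" for T
  proof -
    obtain b where "coef (e T) b \<noteq> 0" using nz coef_eqI[of "e T" 0] by auto
    then show ?thesis using \<delta>(1) by (simp add: coef_e)
  qed
  moreover have "e T \<in> mon_ideal U \<and> homogeneous (d - int (Suc p)) (e T)" for T
  proof -
    have "b \<in> U \<and> int (tdeg b) = d - int (Suc p)" if "coef (e T) b \<noteq> 0" for b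
    proof -
      have "b + ind T - ind T = b" by (simp add: fun_eq_iff)
      then show ?thesis
        using \<delta>(1,4)[of "b + ind T" T] that
        by (simp add: coef_e in_strand_def tdeg_add tdeg_ind)
    qed
    then show ?thesis by (simp add: mon_ideal_def homogeneous_coef)
  qed
  ultimately show ?thesis by blast
qed

text \<open>The Koszul complex of the polynomial ring is a resolution of the residue field. Cycles at \<open>p = 0\<close> are
polynomials; they are boundaries if the constant term vanishes.\<close>

lemma koszul_acyclic:
  fixes c :: "'v::finite set \<Rightarrow> ('v, 'k::field) mpoly"
  assumes card: "\<And>T. c T \<noteq> 0 \<Longrightarrow> card T = p"
    and hom: "\<And>T. homogeneous (d - int p) (c T)"
    and cycle: "\<And>S. koszul_diff X c S = 0"
    and const: "\<And>T. coef (c T) 0 = 0"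
  shows "\<exists>e. (\<forall>T. e T \<noteq> 0 \<longrightarrow> card T = Suc p) \<and>
    (\<forall>T. homogeneous (d - int (Suc p)) (e T)) \<and> koszul_diff X e = c"
proof (cases "d = 0")
  case False
  have "koszul_exact TYPE('k) UNIV p b" if "int (tdeg b) = d" for b :: "'v \<Rightarrow> nat"
  proof -
    have "tdeg b > 0" using that False by auto
    then show ?thesis using tdeg_pos koszul_exact_UNIV by blast
  qed
  then show ?thesis
    using koszul_cycle_lift[where U = UNIV and c = c and p = p and d = d] card hom cycle
    by (auto simp: mon_ideal_def)
next
  case True
  have "c T = 0" for T
  proof (rule coef_eqI)
    fix b
    show "coef (c T) b = coef 0 b"
    proof (rule ccontr)
      assume "\<not> ?thesis"
      then have "coef (c T) b \<noteq> 0" by simp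
      then have "tdeg b = 0" using hom[of T] True by (force simp: homogeneous_coef)
      then have "b = 0" unfolding tdeg_def by (simp add: fun_eq_iff)
      with \<open>coef (c T) b \<noteq> 0\<close> const show False by simp
    qed
  qed
  then have "c = (\<lambda>_. 0)" by auto
  then show ?thesis by (intro exI[of _ "\<lambda>_. 0"]) simp
qed

section \<open>Vanishing of Koszul homology along minimal presentations\<close>

text \<open>Vectors over the polynomial ring are functions on the natural numbers that vanish from some index
on. The map \<open>lin n g\<close> sends the \<open>a\<close>-th basis vector to \<open>g a\<close>.\<close>

definition lin :: "nat \<Rightarrow> (nat \<Rightarrow> nat \<Rightarrow> 'r::comm_ring_1) \<Rightarrow> (nat \<Rightarrow> 'r) \<Rightarrow> nat \<Rightarrow> 'r" where
  "lin n g w b = (\<Sum>a<n. w a * g a b)"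

definition vecs :: "nat \<Rightarrow> (nat \<Rightarrow> 'r::zero) set" where
  "vecs n = {w. \<forall>a\<ge>n. w a = 0}"

definition syz :: "nat \<Rightarrow> (nat \<Rightarrow> nat \<Rightarrow> 'r::comm_ring_1) \<Rightarrow> (nat \<Rightarrow> 'r) set" where
  "syz n g = {w \<in> vecs n. lin n g w = 0}"

text \<open>The Koszul homology of the submodule \<open>Z\<close> vanishes at \<open>p\<close> in degree \<open>d\<close>; here \<open>Z\<close> lies in a free module
whose \<open>a\<close>-th basis vector has degree \<open>sh a\<close>. The bounding chain may be inhomogeneous: for graded
\<open>Z\<close> its component of degree \<open>d\<close> bounds as well.\<close>

definition koszul_vanishes ::
  "(nat \<Rightarrow> ('v::finite, 'k::field) mpoly) set \<Rightarrow> (nat \<Rightarrow> int) \<Rightarrow> nat \<Rightarrow> int \<Rightarrow> bool" where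
  "koszul_vanishes Z sh p d \<longleftrightarrow>
     (\<forall>c. (\<forall>T. c T \<in> Z) \<longrightarrow> (\<forall>T. c T \<noteq> 0 \<longrightarrow> card T = p) \<longrightarrow>
        (\<forall>T a. homogeneous (d - int p - sh a) (c T a)) \<longrightarrow>
        (\<forall>S a. koszul_diff X (\<lambda>T. c T a) S = 0) \<longrightarrow>
        (\<exists>e. (\<forall>T. e T \<in> Z) \<and> (\<forall>S a. koszul_diff X (\<lambda>T. e T a) S = c S a)))"

text \<open>The inequality \<open>reg Z \<le> D\<close> in terms of \<open>Tor(Z, k)\<close>, computed by the Koszul complex.\<close>

definition tor_bound :: "(nat \<Rightarrow> ('v::finite, 'k::field) mpoly) set \<Rightarrow> (nat \<Rightarrow> int) \<Rightarrow> int \<Rightarrow> bool" where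
  "tor_bound Z sh D \<longleftrightarrow> (\<forall>p d. d > int p + D \<longrightarrow> koszul_vanishes Z sh p d)"

definition minimal_presentation ::
  "(nat \<Rightarrow> ('v::finite, 'k::field) mpoly) set \<Rightarrow> (nat \<Rightarrow> int) \<Rightarrow>
   nat \<Rightarrow> (nat \<Rightarrow> int) \<Rightarrow> (nat \<Rightarrow> nat \<Rightarrow> ('v, 'k) mpoly) \<Rightarrow> bool" where
  "minimal_presentation Z sh n sh' g \<longleftrightarrow>
     (\<forall>a<n. \<forall>b. homogeneous (sh' a - sh b) (g a b)) \<and> lin n g ` vecs n = Z \<and>
     (\<forall>w\<in>syz n g. \<forall>a. coef (w a) 0 = 0)"

lemma lin_minus: "lin n g (\<lambda>a. u a - w a) b = lin n g u b - lin n g w b"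
  by (simp add: lin_def algebra_simps sum_subtractf)

lemma lin_koszul_diff:
  "lin n g (\<lambda>a. koszul_diff X (\<lambda>T. c T a) S) b = koszul_diff X (\<lambda>T. lin n g (c T) b) S"
  unfolding lin_def by (simp add: koszul_diff_sum_mult)

lemma koszul_sign_empty [simp]: "koszul_sign v {} = 1"
  by (simp add: koszul_sign_def)

lemma coef_X_mult_zero: "coef (X v * p) 0 = 0"
  by (simp add: coef_X_mult)

text \<open>Suppose that a basis vector has degree above \<open>D\<close>. By vanishing at \<open>p = 0\<close>, its image is a combination of
elements of \<open>Z\<close> with variables as coefficients. Lifting these elements gives a syzygy in which the
coefficient of the basis vector has constant term \<open>1\<close>, against minimality.\<close>

lemma minimal_presentation_shift_le:
  fixes Z :: "(nat \<Rightarrow> ('v::finite, 'k::field) mpoly) set"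
  assumes pres: "minimal_presentation Z sh n sh' g" and bound: "tor_bound Z sh D" and a: "a < n"
  shows "sh' a \<le> D"
proof (rule ccontr)
  assume "\<not> ?thesis"
  then have vanish: "koszul_vanishes Z sh 0 (sh' a)" using bound by (simp add: tor_bound_def)
  have im: "lin n g ` vecs n = Z" using pres by (simp add: minimal_presentation_def)
  define u :: "nat \<Rightarrow> ('v, 'k) mpoly" where "u b = (if b = a then 1 else 0)" for b
  have u: "u \<in> vecs n" "lin n g u = g a"
    using a by (auto simp: u_def vecs_def lin_def fun_eq_iff if_distrib[of "\<lambda>x. x * _"] cong: if_cong)
  have zero: "0 \<in> Z"
    unfolding im[symmetric] by (rule image_eqI[of _ _ 0]) (auto simp: lin_def vecs_def fun_eq_iff)
  have ga: "g a \<in> Z" using u im by (metis imageI)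
  define c where "c T = (if T = {} then g a else 0)" for T :: "'v set"
  have "\<forall>T. c T \<in> Z" using ga zero by (simp add: c_def)
  moreover have "\<forall>T. c T \<noteq> 0 \<longrightarrow> card T = 0" by (simp add: c_def)
  moreover have "\<forall>T b. homogeneous (sh' a - int 0 - sh b) (c T b)"
    using pres a by (simp add: c_def minimal_presentation_def)
  moreover have "\<forall>S b. koszul_diff X (\<lambda>T. c T b) S = 0"
    by (simp add: koszul_diff_def c_def)
  ultimately obtain e where e: "\<And>T. e T \<in> Z" "\<And>S b. koszul_diff X (\<lambda>T. e T b) S = c S b"
    using vanish unfolding koszul_vanishes_def by blast
  have e0: "koszul_diff X (\<lambda>T. e T b) {} = g a b" for b
    using e(2)[of b "{}"] by (simp add: c_def)
  have "\<exists>h. h \<in> vecs n \<and> lin n g h = e T" for T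
    using e(1)[of T] unfolding im[symmetric] by auto
  then obtain h where h: "\<And>T. h T \<in> vecs n" "\<And>T. lin n g (h T) = e T" by metis
  define w where "w b = u b - koszul_diff X (\<lambda>T. h T b) {}" for b
  have "w \<in> syz n g"
  proof -
    have "lin n g w b = 0" for b
      unfolding w_def lin_minus lin_koszul_diff h(2) e0 u(2) by simp
    moreover have "w \<in> vecs n" using u(1) h(1) by (auto simp: w_def vecs_def koszul_diff_def)
    ultimately show ?thesis by (auto simp: syz_def)
  qed
  then have "coef (w a) 0 = 0" using pres by (simp add: minimal_presentation_def)
  moreover have "coef (w a) 0 = 1"
  proof -
    have "coef (1 :: ('v, 'k) mpoly) 0 = 1"
      unfolding coef_def by (simp add: lookup_one zero_fun_def)
    then show ?thesis
      by (simp add: w_def u_def koszul_diff_def coef_minus coef_sum coef_X_mult_zero)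
  qed
  ultimately show False by simp
qed

text \<open>The connecting homomorphism of \<open>0 \<rightarrow> syz n g \<rightarrow> F \<rightarrow> Z \<rightarrow> 0\<close> with \<open>F\<close> free. A cycle \<open>c\<close> of syzygies bounds a
chain \<open>e\<close> of \<open>F\<close>, as \<open>F\<close> is acyclic; for \<open>p = 0\<close> this is where minimality enters. The image of \<open>e\<close> in \<open>Z\<close> is
a cycle, hence a boundary, and correcting \<open>e\<close> by a lift of a bounding chain moves it into the
syzygies.\<close>

lemma tor_bound_syz:
  fixes Z :: "(nat \<Rightarrow> ('v::finite, 'k::field) mpoly) set"
  assumes pres: "minimal_presentation Z sh n sh' g" and bound: "tor_bound Z sh D"
  shows "tor_bound (syz n g) sh' (D + 1)"
  unfolding tor_bound_def koszul_vanishes_def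
proof (intro allI impI)
  fix p d and c :: "'v set \<Rightarrow> nat \<Rightarrow> ('v, 'k) mpoly"
  assume d: "int p + (D + 1) < d"
    and c: "\<forall>T. c T \<in> syz n g" and card: "\<forall>T. c T \<noteq> 0 \<longrightarrow> card T = p"
    and hom: "\<forall>T a. homogeneous (d - int p - sh' a) (c T a)"
    and cycle: "\<forall>S a. koszul_diff X (\<lambda>T. c T a) S = 0"
  have im: "lin n g ` vecs n = Z" and gh: "\<And>a b. a < n \<Longrightarrow> homogeneous (sh' a - sh b) (g a b)"
    using pres by (auto simp: minimal_presentation_def)
  define Q where "Q a e \<longleftrightarrow> (\<forall>T. e T \<noteq> 0 \<longrightarrow> card T = Suc p) \<and>
      (\<forall>T. homogeneous (d - sh' a - int (Suc p)) (e T)) \<and> koszul_diff X e = (\<lambda>T. c T a) \<and>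
      (a \<ge> n \<longrightarrow> e = (\<lambda>_. 0))" for a and e :: "'v set \<Rightarrow> ('v, 'k) mpoly"
  have "\<exists>e. Q a e" for a
  proof (cases "a < n")
    case True
    have "\<exists>e. (\<forall>T. e T \<noteq> 0 \<longrightarrow> card T = Suc p) \<and>
        (\<forall>T. homogeneous (d - sh' a - int (Suc p)) (e T)) \<and> koszul_diff X e = (\<lambda>T. c T a)"
    proof (rule koszul_acyclic)
      show "card T = p" if "c T a \<noteq> 0" for T using card that by (metis zero_fun_apply)
      show "homogeneous (d - sh' a - int p) (c T a)" for T
        using hom by (simp add: algebra_simps)
      show "koszul_diff X (\<lambda>T. c T a) S = 0" for S using cycle by blast
      show "coef (c T a) 0 = 0" for T
        using pres c by (auto simp: minimal_presentation_def)
    qed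
    with True show ?thesis unfolding Q_def by auto
  next
    case False
    then have "c T a = 0" for T using c by (auto simp: syz_def vecs_def)
    then show ?thesis unfolding Q_def by (intro exI[of _ "\<lambda>_. 0"]) (auto simp: fun_eq_iff)
  qed
  then obtain \<epsilon> where "\<And>a. Q a (\<epsilon> a)" by metis
  then have \<epsilon>: "\<And>a T. \<epsilon> a T \<noteq> 0 \<Longrightarrow> card T = Suc p"
    "\<And>a T. homogeneous (d - sh' a - int (Suc p)) (\<epsilon> a T)"
    "\<And>a. koszul_diff X (\<epsilon> a) = (\<lambda>T. c T a)" "\<And>a. a \<ge> n \<Longrightarrow> \<epsilon> a = (\<lambda>_. 0)"
    unfolding Q_def by blast+
  define e where "e T a = \<epsilon> a T" for T a
  have e_vec: "e T \<in> vecs n" for T using \<epsilon>(4) by (simp add: e_def vecs_def)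
  have de: "koszul_diff X (\<lambda>T. e T a) S = c S a" for S a
    using \<epsilon>(3)[of a] by (simp add: e_def fun_eq_iff)
  define f where "f T = lin n g (e T)" for T
  have "koszul_vanishes Z sh (Suc p) d" using bound d by (simp add: tor_bound_def)
  moreover have "\<forall>T. f T \<in> Z" using e_vec im by (auto simp: f_def)
  moreover have "\<forall>T. f T \<noteq> 0 \<longrightarrow> card T = Suc p"
  proof (intro allI impI)
    fix T assume "f T \<noteq> 0"
    then obtain b where "f T b \<noteq> 0" by (metis ext zero_fun_apply)
    then obtain a where "e T a * g a b \<noteq> 0"
      unfolding f_def lin_def by (auto elim!: sum.not_neutral_contains_not_neutral)
    then have "e T a \<noteq> 0" by (metis mult_zero_left)
    then show "card T = Suc p" using \<epsilon>(1) by (auto simp: e_def)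
  qed
  moreover have "\<forall>T b. homogeneous (d - int (Suc p) - sh b) (f T b)"
  proof (intro allI)
    fix T b
    have "homogeneous (d - int (Suc p) - sh b) (e T a * g a b)" if "a < n" for a
      using homogeneous_mult[OF \<epsilon>(2)[of a T] gh[OF that, of b]] by (simp add: e_def algebra_simps)
    then show "homogeneous (d - int (Suc p) - sh b) (f T b)"
      unfolding f_def lin_def by (intro homogeneous_sum) auto
  qed
  moreover have "\<forall>S b. koszul_diff X (\<lambda>T. f T b) S = 0"
  proof (intro allI)
    fix S b
    have "koszul_diff X (\<lambda>T. f T b) S = lin n g (c S) b"
      unfolding f_def lin_koszul_diff[symmetric] de ..
    then show "koszul_diff X (\<lambda>T. f T b) S = 0" using c by (simp add: syz_def)
  qed
  ultimately obtain q where q: "\<And>T. q T \<in> Z" "\<And>S b. koszul_diff X (\<lambda>T. q T b) S = f S b"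
    unfolding koszul_vanishes_def by blast
  have "\<exists>h. h \<in> vecs n \<and> lin n g h = q T" for T
    using q(1)[of T] unfolding im[symmetric] by auto
  then obtain h where h: "\<And>T. h T \<in> vecs n" "\<And>T. lin n g (h T) = q T" by metis
  \<comment> \<open>Boundaries are cycles, so the correction does not change the boundary of \<open>e\<close>.\<close>
  define e' where "e' T a = e T a - koszul_diff X (\<lambda>T. h T a) T" for T a
  have "e' T \<in> syz n g" for T
  proof -
    have "lin n g (e' T) b = 0" for b
      unfolding e'_def lin_minus lin_koszul_diff h(2) q(2) f_def by simp
    moreover have "e' T \<in> vecs n"
      using e_vec[of T] h(1) by (auto simp: e'_def vecs_def koszul_diff_def)
    ultimately show ?thesis by (auto simp: syz_def)
  qed
  moreover have "koszul_diff X (\<lambda>T. e' T a) S = c S a" for S a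
    unfolding e'_def koszul_diff_minus de koszul_diff_diff by simp
  ultimately show "\<exists>e. (\<forall>T. e T \<in> syz n g) \<and> (\<forall>S a. koszul_diff X (\<lambda>T. e T a) S = c S a)"
    by blast
qed

text \<open>An ideal as a submodule of the free module of rank one.\<close>

definition ideal_vecs :: "'r::zero set \<Rightarrow> (nat \<Rightarrow> 'r) set" where
  "ideal_vecs I = {w \<in> vecs 1. w 0 \<in> I}"

lemma tor_bound_mon_ideal:
  fixes U :: "('v::finite \<Rightarrow> nat) set"
  assumes "reg_le TYPE('k::field) U r"
  shows "tor_bound (ideal_vecs (mon_ideal U) :: (nat \<Rightarrow> ('v, 'k) mpoly) set) (\<lambda>_. 0) r"
  unfolding tor_bound_def koszul_vanishes_def
proof (intro allI impI)
  fix p d and c :: "'v set \<Rightarrow> nat \<Rightarrow> ('v, 'k) mpoly"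
  assume d: "int p + r < d"
    and c: "\<forall>T. c T \<in> ideal_vecs (mon_ideal U)" and card: "\<forall>T. c T \<noteq> 0 \<longrightarrow> card T = p"
    and hom: "\<forall>T a. homogeneous (d - int p - 0) (c T a)"
    and cycle: "\<forall>S a. koszul_diff X (\<lambda>T. c T a) S = 0"
  have "\<exists>e. (\<forall>T. e T \<noteq> 0 \<longrightarrow> card T = Suc p) \<and> (\<forall>T. e T \<in> mon_ideal U) \<and>
    (\<forall>T. homogeneous (d - int (Suc p)) (e T)) \<and> koszul_diff X e = (\<lambda>T. c T 0)"
  proof (rule koszul_cycle_lift)
    show "koszul_exact TYPE('k) U p b" if "int (tdeg b) = d" for b
      using assms d that by (simp add: reg_le_def)
    show "card T = p" if "c T 0 \<noteq> 0" for T using card that by (metis zero_fun_apply)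
    show "c T 0 \<in> mon_ideal U" for T using c by (simp add: ideal_vecs_def)
    show "homogeneous (d - int p) (c T 0)" for T using hom by simp
    show "koszul_diff X (\<lambda>T. c T 0) S = 0" for S using cycle by blast
  qed
  then obtain e where e: "\<And>T. e T \<in> mon_ideal U" "koszul_diff X e = (\<lambda>T. c T 0)" by blast
  have c0: "c T a = 0" if "a \<noteq> 0" for T a using c that by (auto simp: ideal_vecs_def vecs_def)
  show "\<exists>e. (\<forall>T. e T \<in> ideal_vecs (mon_ideal U)) \<and> (\<forall>S a. koszul_diff X (\<lambda>T. e T a) S = c S a)"
  proof (intro exI[of _ "\<lambda>T a. if a = 0 then e T else 0"] conjI allI)
    fix S a
    show "koszul_diff X (\<lambda>T. if a = 0 then e T else 0) S = c S a"
      using e(2) c0 by (cases "a = 0") (simp_all add: fun_eq_iff)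
  qed (use e(1) in \<open>auto simp: ideal_vecs_def vecs_def\<close>)
qed

section \<open>Graded submodules and existence of minimal presentations\<close>

definition vscale :: "'r::comm_ring_1 \<Rightarrow> (nat \<Rightarrow> 'r) \<Rightarrow> nat \<Rightarrow> 'r" where
  "vscale s w a = s * w a"

definition kscale :: "'k::field \<Rightarrow> (nat \<Rightarrow> ('v, 'k) mpoly) \<Rightarrow> nat \<Rightarrow> ('v, 'k) mpoly" where
  "kscale c = vscale (Poly_Mapping.single 0 c)"

interpretation vec: module vscale
  by unfold_locales (auto simp: vscale_def fun_eq_iff algebra_simps)

interpretation kvec: vector_space kscale
  by unfold_locales
    (auto simp: kscale_def vscale_def fun_eq_iff algebra_simps single_add mult_single
      simp flip: mult.assoc)

lemma sum_apply: "(sum f A) x = (\<Sum>i\<in>A. f i x)"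
  by (induction A rule: infinite_finite_induct) auto

definition hcomp :: "int \<Rightarrow> ('v, 'k::zero) mpoly \<Rightarrow> ('v, 'k) mpoly" where
  "hcomp d p = Abs_poly_mapping (\<lambda>m. if int (mdeg m) = d then Poly_Mapping.lookup p m else 0)"

lemma coef_hcomp: "coef (hcomp d p) b = (if int (tdeg b) = d then coef p b else 0)"
proof -
  have "finite {m. (if int (mdeg m) = d then Poly_Mapping.lookup p m else 0) \<noteq> 0}"
    by (rule finite_subset[OF _ finite_keys[of p]]) (auto simp: in_keys_iff)
  then show ?thesis
    by (simp add: coef_def hcomp_def lookup_Abs_poly_mapping mdeg_tdeg)
qed

lemma homogeneous_hcomp: "homogeneous d (hcomp d p)" for p :: "('v::finite, 'k::zero) mpoly"
  by (simp add: homogeneous_coef coef_hcomp)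

lemma hcomp_id: "homogeneous d p \<Longrightarrow> hcomp d p = p" for p :: "('v::finite, 'k::zero) mpoly"
  by (rule coef_eqI) (auto simp: homogeneous_coef coef_hcomp)

lemma hcomp_sum: "hcomp d (sum f A) = (\<Sum>x\<in>A. hcomp d (f x))"
  for f :: "'i \<Rightarrow> ('v::finite, 'k::comm_ring_1) mpoly"
  by (rule coef_eqI) (auto simp: coef_hcomp coef_sum)

lemma hcomp_zero [simp]: "hcomp d 0 = (0 :: ('v::finite, 'k::comm_ring_1) mpoly)"
  by (rule coef_eqI) (simp add: coef_hcomp)

text \<open>The part of \<open>p\<close> outside degree \<open>d - e\<close> contributes nothing to degree \<open>d\<close> of the product.\<close>

lemma hcomp_mult:
  fixes p q :: "('v::finite, 'k::comm_ring_1) mpoly"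
  assumes q: "homogeneous e q"
  shows "hcomp d (p * q) = hcomp (d - e) p * q"
proof -
  have "hcomp d ((p - hcomp (d - e) p) * q) = 0"
  proof (rule coef_eqI)
    fix b
    have False if nz: "coef ((p - hcomp (d - e) p) * q) b \<noteq> 0" and deg: "int (tdeg b) = d"
    proof -
      obtain k l where kl: "b = k + l" "coef (p - hcomp (d - e) p) k \<noteq> 0" "coef q l \<noteq> 0"
        using coef_mult_nonzero[OF nz] by blast
      then have "int (tdeg k) = d - e" using q deg by (simp add: homogeneous_coef tdeg_add)
      then have "coef (p - hcomp (d - e) p) k = 0" by (simp add: coef_minus coef_hcomp)
      then show False using kl(2) by simp
    qed
    then show "coef (hcomp d ((p - hcomp (d - e) p) * q)) b = coef 0 b"
      by (auto simp: coef_hcomp)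
  qed
  moreover have "hcomp d ((p - hcomp (d - e) p) * q) = hcomp d (p * q) - hcomp d (hcomp (d - e) p * q)"
    by (rule coef_eqI) (simp add: coef_hcomp coef_minus left_diff_distrib)
  moreover have "homogeneous d (hcomp (d - e) p * q)"
    using homogeneous_mult[OF homogeneous_hcomp[of "d - e" p] q] by simp
  ultimately show ?thesis by (simp add: hcomp_id)
qed

lemma homogeneous_X: "homogeneous 1 (X v :: ('v::finite, 'k::comm_ring_1) mpoly)"
  by (auto simp: homogeneous_def X_def mdeg_def)

definition vcomp :: "(nat \<Rightarrow> int) \<Rightarrow> int \<Rightarrow> (nat \<Rightarrow> ('v, 'k::zero) mpoly) \<Rightarrow> nat \<Rightarrow> ('v, 'k) mpoly" where
  "vcomp sh d w a = hcomp (d - sh a) (w a)"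

definition hvecs :: "nat \<Rightarrow> (nat \<Rightarrow> int) \<Rightarrow> int \<Rightarrow> (nat \<Rightarrow> ('v, 'k::zero) mpoly) set" where
  "hvecs m sh d = {w \<in> vecs m. \<forall>a. homogeneous (d - sh a) (w a)}"

definition graded_submodule ::
  "nat \<Rightarrow> (nat \<Rightarrow> int) \<Rightarrow> (nat \<Rightarrow> ('v::finite, 'k::field) mpoly) set \<Rightarrow> bool" where
  "graded_submodule m sh Z \<longleftrightarrow> Z \<subseteq> vecs m \<and> vec.subspace Z \<and> (\<forall>w\<in>Z. \<forall>d. vcomp sh d w \<in> Z)"

lemma finite_mdeg: "finite {k :: 'v::finite \<Rightarrow>\<^sub>0 nat. mdeg k = N}"
proof (rule finite_subset)
  have "u v \<le> N" if "tdeg u = N" for u :: "'v \<Rightarrow> nat" and v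
    using that member_le_sum[of v UNIV u] by (auto simp: tdeg_def)
  then have "k \<in> Abs_poly_mapping ` {u. \<forall>v. u v \<le> N}" if "mdeg k = N" for k :: "'v \<Rightarrow>\<^sub>0 nat"
    using that by (intro image_eqI[of _ _ "Poly_Mapping.lookup k"]) (auto simp: mdeg_tdeg)
  then show "{k :: 'v \<Rightarrow>\<^sub>0 nat. mdeg k = N} \<subseteq> Abs_poly_mapping ` {u. \<forall>v. u v \<le> N}" by auto
  show "finite (Abs_poly_mapping ` {u :: 'v \<Rightarrow> nat. \<forall>v. u v \<le> N})"
    using finite_set_of_finite_funs[of "UNIV :: 'v set" "{..N}" 0] by simp
qed

lemma poly_sum_keys: "p = (\<Sum>k\<in>Poly_Mapping.keys p. Poly_Mapping.single k (Poly_Mapping.lookup p k))"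
  for p :: "('v, 'k::comm_ring_1) mpoly"
proof (rule poly_mapping_eqI)
  fix m
  show "Poly_Mapping.lookup p m =
      Poly_Mapping.lookup (\<Sum>k\<in>Poly_Mapping.keys p. Poly_Mapping.single k (Poly_Mapping.lookup p k)) m"
    by (auto simp: lookup_sum lookup_single when_def in_keys_iff)
qed

text \<open>There are only finitely many monomials of each degree.\<close>

lemma hvecs_finite_span:
  "\<exists>T. finite T \<and> hvecs m sh d \<subseteq> kvec.span (T :: (nat \<Rightarrow> ('v::finite, 'k::field) mpoly) set)"
proof -
  define e :: "nat \<Rightarrow> ('v \<Rightarrow>\<^sub>0 nat) \<Rightarrow> nat \<Rightarrow> ('v, 'k) mpoly"
    where "e a k b = (if b = a then Poly_Mapping.single k 1 else 0)" for a k b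
  define T where "T = (\<Union>a<m. e a ` {k. int (mdeg k) = d - sh a})"
  have "finite {k :: 'v \<Rightarrow>\<^sub>0 nat. int (mdeg k) = d - sh a}" for a
    by (rule finite_subset[OF _ finite_mdeg[of "nat (d - sh a)"]]) auto
  then have "finite T" by (simp add: T_def)
  moreover have "w \<in> kvec.span T" if w: "w \<in> hvecs m sh d" for w
  proof -
    have "w = (\<Sum>a<m. \<Sum>k\<in>Poly_Mapping.keys (w a). kscale (Poly_Mapping.lookup (w a) k) (e a k))"
    proof
      fix b
      have "(\<Sum>k\<in>Poly_Mapping.keys (w a). kscale (Poly_Mapping.lookup (w a) k) (e a k) b) =
          (if a = b then w b else 0)" for a
        using poly_sum_keys[of "w b"]
        by (auto simp: kscale_def vscale_def e_def mult_single)
      then show "w b = (\<Sum>a<m. \<Sum>k\<in>Poly_Mapping.keys (w a). kscale (Poly_Mapping.lookup (w a) k) (e a k)) b"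
        using w by (simp add: sum_apply hvecs_def vecs_def)
    qed
    also have "\<dots> \<in> kvec.span T"
    proof (intro kvec.span_sum kvec.span_scale kvec.span_base)
      fix a k assume "a \<in> {..<m}" "k \<in> Poly_Mapping.keys (w a)"
      then show "e a k \<in> T" using w by (auto simp: T_def hvecs_def homogeneous_def)
    qed
    finally show ?thesis .
  qed
  ultimately show ?thesis by blast
qed

lemma kspan_subset_span: "kvec.span B \<subseteq> vec.span B"
proof (rule kvec.span_minimal)
  show "kvec.subspace (vec.span B)"
    by (rule kvec.subspaceI) (auto simp: kscale_def intro: vec.span_zero vec.span_add vec.span_scale)
qed (rule vec.span_superset)

text \<open>Vanishing at \<open>p = 0\<close> says that homogeneous elements of degree above \<open>D\<close> are combinations of elements of
lower degree. So vector space bases of the finitely many nonzero components of degree at most \<open>D\<close>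
generate \<open>Z\<close>.\<close>

lemma graded_finite_generators:
  fixes Z :: "(nat \<Rightarrow> ('v::finite, 'k::field) mpoly) set"
  assumes Z: "graded_submodule m sh Z" and bound: "tor_bound Z sh D"
  shows "\<exists>G. finite G \<and> G \<subseteq> Z \<inter> (\<Union>d. hvecs m sh d) \<and> vec.span G = Z"
proof -
  have Zv: "Z \<subseteq> vecs m" and Zs: "vec.subspace Z" and Zc: "\<And>w d. w \<in> Z \<Longrightarrow> vcomp sh d w \<in> Z"
    using Z by (auto simp: graded_submodule_def)
  have "\<exists>B. finite B \<and> B \<subseteq> Z \<inter> hvecs m sh d \<and> Z \<inter> hvecs m sh d \<subseteq> kvec.span B" for d
  proof -
    obtain T where T: "finite T" "hvecs m sh d \<subseteq> kvec.span (T :: (nat \<Rightarrow> ('v, 'k) mpoly) set)"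
      using hvecs_finite_span by blast
    obtain B where B: "B \<subseteq> Z \<inter> hvecs m sh d" "kvec.independent B" "Z \<inter> hvecs m sh d \<subseteq> kvec.span B"
      using kvec.maximal_independent_subset by blast
    have "B \<subseteq> kvec.span T" using B(1) T(2) by blast
    with kvec.independent_span_bound[OF T(1) B(2)] B show ?thesis by blast
  qed
  then obtain B where B: "\<And>d. finite (B d)" "\<And>d. B d \<subseteq> Z \<inter> hvecs m sh d"
    "\<And>d. Z \<inter> hvecs m sh d \<subseteq> kvec.span (B d)"
    by metis
  \<comment> \<open>Below \<open>lo\<close> there are no nonzero homogeneous vectors; \<open>lo \<le> D\<close> lets the induction below step down from
    any degree above \<open>D\<close>.\<close>
  define lo where "lo = Min (insert D (sh ` {..<m}))"
  have lo: "lo \<le> D" "\<And>a. a < m \<Longrightarrow> lo \<le> sh a" by (auto simp: lo_def)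
  define G where "G = (\<Union>d\<in>{lo..D}. B d)"
  have G: "finite G" "G \<subseteq> Z \<inter> (\<Union>d. hvecs m sh d)"
  proof -
    show "finite G" using B(1) by (simp add: G_def)
    show "G \<subseteq> Z \<inter> (\<Union>d. hvecs m sh d)" unfolding G_def using B(2) by blast
  qed
  have hom: "w \<in> vec.span G" if "w \<in> Z" "w \<in> hvecs m sh d" for w d
    using that
  proof (induction "nat (d - lo)" arbitrary: d w rule: less_induct)
    case less
    consider "d < lo" | "lo \<le> d" "d \<le> D" | "D < d" by linarith
    then show ?case
    proof cases
      case 1
      have "w a = 0" for a
      proof (cases "a < m")
        case True
        have "coef (w a) b = 0" for b
        proof (rule ccontr)
          assume "coef (w a) b \<noteq> 0"
          then have "int (tdeg b) = d - sh a"
            using less.prems(2) by (auto simp: hvecs_def homogeneous_coef)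
          then show False using 1 lo(2)[OF True] by simp
        qed
        then show ?thesis by (intro coef_eqI) simp
      qed (use less.prems Zv in \<open>auto simp: vecs_def\<close>)
      then have "w = 0" by (simp add: fun_eq_iff)
      then show ?thesis by (simp add: vec.span_zero)
    next
      case 2
      then have "w \<in> kvec.span (B d)" using less.prems B(3) by blast
      then have "w \<in> vec.span (B d)" using kspan_subset_span by blast
      moreover have "B d \<subseteq> G" using 2 by (auto simp: G_def)
      ultimately show ?thesis using vec.span_mono by blast
    next
      case 3
      have vanish: "koszul_vanishes Z sh 0 d" using bound 3 by (simp add: tor_bound_def)
      define c where "c T = (if T = {} then w else 0)" for T :: "'v set"
      have "\<forall>T. c T \<in> Z" using less.prems(1) vec.subspace_0[OF Zs] by (simp add: c_def)
      moreover have "\<forall>T. c T \<noteq> 0 \<longrightarrow> card T = 0" by (simp add: c_def)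
      moreover have "\<forall>T b. homogeneous (d - int 0 - sh b) (c T b)"
        using less.prems(2) by (simp add: c_def hvecs_def)
      moreover have "\<forall>S b. koszul_diff X (\<lambda>T. c T b) S = 0" by (simp add: koszul_diff_def c_def)
      ultimately obtain e where e: "\<And>T. e T \<in> Z" "\<And>S b. koszul_diff X (\<lambda>T. e T b) S = c S b"
        using vanish unfolding koszul_vanishes_def by blast
      define z where "z v = vcomp sh (d - 1) (e {v})" for v
      have z: "z v \<in> Z" "z v \<in> hvecs m sh (d - 1)" for v
      proof -
        show "z v \<in> Z" using Zc e(1) by (simp add: z_def)
        then show "z v \<in> hvecs m sh (d - 1)"
          using Zv by (auto simp: hvecs_def z_def vcomp_def homogeneous_hcomp)
      qed
      have "w = (\<Sum>v\<in>UNIV. vscale (X v) (z v))"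
      proof
        fix a
        have "w a = (\<Sum>v\<in>UNIV. e {v} a * X v)"
          using e(2)[of a "{}"] by (simp add: c_def koszul_diff_def mult.commute)
        moreover have "w a = hcomp (d - sh a) (w a)"
          using less.prems(2) by (simp add: hvecs_def hcomp_id)
        ultimately have "w a = (\<Sum>v\<in>UNIV. hcomp (d - sh a) (e {v} a * X v))"
          by (simp add: hcomp_sum)
        also have "\<dots> = (\<Sum>v\<in>UNIV. vscale (X v) (z v) a)"
          unfolding hcomp_mult[OF homogeneous_X]
          by (simp add: vscale_def z_def vcomp_def algebra_simps)
        finally show "w a = (\<Sum>v\<in>UNIV. vscale (X v) (z v)) a" by (simp add: sum_apply)
      qed
      moreover have "z v \<in> vec.span G" for v
        using z less.hyps[of "d - 1" "z v"] 3 lo(1) by simp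
      ultimately show ?thesis by (simp add: vec.span_sum vec.span_scale)
    qed
  qed
  have "z \<in> vec.span G" if z: "z \<in> Z" for z
  proof -
    define I where "I = (\<Union>a<m. (\<lambda>k. int (mdeg k) + sh a) ` Poly_Mapping.keys (z a))"
    have fin: "finite I" by (simp add: I_def)
    have "z = (\<Sum>d\<in>I. vcomp sh d z)"
    proof (rule ext, rule coef_eqI)
      fix a b
      have "coef ((\<Sum>d\<in>I. vcomp sh d z) a) b = (\<Sum>d\<in>I. if d = int (tdeg b) + sh a then coef (z a) b else 0)"
        unfolding sum_apply coef_sum by (rule sum.cong) (auto simp: vcomp_def coef_hcomp)
      also have "\<dots> = coef (z a) b"
      proof (cases "coef (z a) b = 0")
        case False
        have "z a = 0" if "a \<ge> m" using z Zv that by (auto simp: vecs_def)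
        then have "a < m" using False by (cases "a < m") simp_all
        moreover have "Abs_poly_mapping b \<in> Poly_Mapping.keys (z a)"
          using False by (simp add: coef_def in_keys_iff)
        ultimately have "int (tdeg b) + sh a \<in> I"
          unfolding I_def by (force simp: mdeg_tdeg)
        then show ?thesis using fin by simp
      qed (simp cong: if_cong)
      finally show "coef (z a) b = coef ((\<Sum>d\<in>I. vcomp sh d z) a) b" ..
    qed
    moreover have "vcomp sh d z \<in> vec.span G" for d
    proof (rule hom)
      show "vcomp sh d z \<in> Z" using Zc z by blast
      then show "vcomp sh d z \<in> hvecs m sh d"
        using Zv by (auto simp: hvecs_def vcomp_def homogeneous_hcomp)
    qed
    ultimately show ?thesis by (metis vec.span_sum)
  qed
  moreover have "vec.span G \<subseteq> Z" using G(2) Zs by (intro vec.span_minimal) auto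
  ultimately show ?thesis using G by blast
qed

lemma lin_vscale: "lin n g w = (\<Sum>a<n. vscale (w a) (g a))"
  by (rule ext) (simp add: lin_def sum_apply vscale_def)

text \<open>Take a homogeneous generating set of least size. If a syzygy had a coefficient with nonzero constant
term, its homogeneous component in the degree of the corresponding generator would express that
generator by the others.\<close>

lemma exists_minimal_presentation:
  fixes Z :: "(nat \<Rightarrow> ('v::finite, 'k::field) mpoly) set"
  assumes Z: "graded_submodule m sh Z" and bound: "tor_bound Z sh D"
  shows "\<exists>n sh' g. minimal_presentation Z sh n sh' g \<and> (\<forall>a<n. g a \<in> Z)"
proof -
  let ?P = "\<lambda>G. finite G \<and> G \<subseteq> Z \<inter> (\<Union>d. hvecs m sh d) \<and> vec.span G = Z"
  obtain G0 where "?P G0" using graded_finite_generators[OF assms] by blast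
  from ex_has_least_nat[of ?P G0 card, OF this]
  obtain G where "?P G \<and> (\<forall>G'. ?P G' \<longrightarrow> card G \<le> card G')" by (elim exE)
  then have G: "?P G" "\<And>G'. ?P G' \<Longrightarrow> card G \<le> card G'" by blast+
  define n where "n = card G"
  obtain g where g: "bij_betw g {..<n} G"
    using ex_bij_betw_nat_finite[of G] G(1) unfolding n_def atLeast0LessThan by blast
  have gG: "g a \<in> G" if "a < n" for a using g that by (auto simp: bij_betw_def)
  have "\<forall>a. \<exists>d. a < n \<longrightarrow> g a \<in> hvecs m sh d" using gG G(1) by blast
  then obtain sh' where sh': "\<And>a. a < n \<Longrightarrow> g a \<in> hvecs m sh (sh' a)" by metis
  have hom: "homogeneous (sh' a - sh b) (g a b)" if "a < n" for a b
    using sh'[OF that] by (simp add: hvecs_def)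
  have image: "lin n g ` vecs n = Z"
  proof
    show "lin n g ` vecs n \<subseteq> Z"
    proof clarify
      fix w
      have "lin n g w \<in> vec.span G"
        unfolding lin_vscale using gG by (intro vec.span_sum vec.span_scale vec.span_base) simp
      then show "lin n g w \<in> Z" using G(1) by simp
    qed
    show "Z \<subseteq> lin n g ` vecs n"
    proof
      fix z assume "z \<in> Z"
      then obtain u where u: "z = (\<Sum>v\<in>G. vscale (u v) v)"
        using G(1) vec.span_finite[of G] by auto
      define w where "w a = (if a < n then u (g a) else 0)" for a
      have "z = (\<Sum>a<n. vscale (u (g a)) (g a))"
        unfolding u using sum.reindex_bij_betw[OF g, of "\<lambda>v. vscale (u v) v"] by simp
      then have "z = lin n g w" unfolding lin_vscale by (simp add: w_def)
      moreover have "w \<in> vecs n" by (simp add: w_def vecs_def)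
      ultimately show "z \<in> lin n g ` vecs n" by blast
    qed
  qed
  have min: "coef (w a) 0 = 0" if w: "w \<in> syz n g" for w a
  proof (rule ccontr)
    let ?\<kappa> = "coef (w a) 0"
    assume nz: "?\<kappa> \<noteq> 0"
    have "w a = 0" if "a \<ge> n" using w that by (simp add: syz_def vecs_def)
    then have a: "a < n" using nz by (cases "a < n") simp_all
    \<comment> \<open>The component of the syzygy in the degree of the generator \<open>g a\<close>: its coefficient at \<open>a\<close> is constant.\<close>
    define w' where "w' b = hcomp (sh' a - sh' b) (w b)" for b
    have "lin n g w' = 0"
    proof
      fix c
      have "lin n g w' c = (\<Sum>b<n. hcomp (sh' a - sh c) (w b * g b c))"
        unfolding lin_def w'_def
      proof (rule sum.cong[OF refl])
        fix b assume "b \<in> {..<n}"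
        then have "homogeneous (sh' b - sh c) (g b c)" using hom by simp
        from hcomp_mult[OF this, of "sh' a - sh c" "w b"]
        show "hcomp (sh' a - sh' b) (w b) * g b c = hcomp (sh' a - sh c) (w b * g b c)" by simp
      qed
      also have "\<dots> = hcomp (sh' a - sh c) (lin n g w c)" by (simp add: lin_def hcomp_sum)
      finally show "lin n g w' c = 0 c" using w by (simp add: syz_def)
    qed
    then have sum0: "vscale (w' a) (g a) + (\<Sum>b\<in>{..<n} - {a}. vscale (w' b) (g b)) = 0"
      using a by (simp add: lin_vscale sum.remove[of "{..<n}" a])
    have "w' a = Poly_Mapping.single 0 ?\<kappa>"
    proof (rule coef_eqI)
      fix b :: "'v \<Rightarrow> nat"
      have "tdeg b = 0 \<longleftrightarrow> b = 0" by (simp add: tdeg_def fun_eq_iff)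
      moreover have "Abs_poly_mapping b = 0 \<longleftrightarrow> b = 0" for b :: "'v \<Rightarrow> nat"
      proof
        assume "Abs_poly_mapping b = 0"
        from arg_cong[OF this, of Poly_Mapping.lookup] show "b = 0" by (simp add: fun_eq_iff)
      next
        assume "b = 0"
        then show "Abs_poly_mapping b = 0" by (intro poly_mapping_eqI) simp
      qed
      ultimately show "coef (w' a) b = coef (Poly_Mapping.single 0 ?\<kappa>) b"
        by (auto simp: w'_def coef_hcomp coef_def[of "Poly_Mapping.single _ _"] lookup_single when_def)
    qed
    then have inv: "vscale (Poly_Mapping.single 0 (1 / ?\<kappa>)) (vscale (w' a) (g a)) = g a"
      using nz by (simp add: vscale_def fun_eq_iff mult_single flip: mult.assoc)
    have neg: "vscale (w' a) (g a) = - (\<Sum>b\<in>{..<n} - {a}. vscale (w' b) (g b))"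
      using sum0 by (simp add: eq_neg_iff_add_eq_0)
    have "(\<Sum>b\<in>{..<n} - {a}. vscale (w' b) (g b)) \<in> vec.span (G - {g a})"
    proof (intro vec.span_sum vec.span_scale vec.span_base)
      fix b assume "b \<in> {..<n} - {a}"
      then show "g b \<in> G - {g a}" using g a gG by (auto simp: bij_betw_def inj_on_def)
    qed
    then have "vscale (w' a) (g a) \<in> vec.span (G - {g a})"
      unfolding neg by (rule vec.span_neg)
    from vec.span_scale[OF this] have "g a \<in> vec.span (G - {g a})"
      by (subst inv[symmetric])
    then have "vec.span (insert (g a) (G - {g a})) = vec.span (G - {g a})"
      unfolding vec.span_eq using vec.span_superset by (auto intro: vec.span_base)
    then have "?P (G - {g a})" using G(1) gG[OF a] by (simp add: insert_absorb) blast
    from G(2)[OF this] show False using G(1) gG[OF a] card_Diff1_less[of G "g a"] by simp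
  qed
  have "minimal_presentation Z sh n sh' g"
    unfolding minimal_presentation_def using hom image min by blast
  then show ?thesis using gG G(1) by blast
qed

lemma lin_vcomp:
  assumes "\<And>a b. a < n \<Longrightarrow> homogeneous (sh' a - sh b) (g a b :: ('v::finite, 'k::comm_ring_1) mpoly)"
  shows "lin n g (vcomp sh' d w) = vcomp sh d (lin n g w)"
proof
  fix b
  have "vcomp sh d (lin n g w) b = (\<Sum>a<n. hcomp (d - sh b) (w a * g a b))"
    by (simp add: vcomp_def lin_def hcomp_sum)
  also have "\<dots> = (\<Sum>a<n. hcomp (d - sh' a) (w a) * g a b)"
  proof (rule sum.cong[OF refl])
    fix a assume "a \<in> {..<n}"
    with hcomp_mult[OF assms[of a b], where d = "d - sh b" and p = "w a"]
    show "hcomp (d - sh b) (w a * g a b) = hcomp (d - sh' a) (w a) * g a b" by simp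
  qed
  finally show "lin n g (vcomp sh' d w) b = vcomp sh d (lin n g w) b"
    by (simp add: lin_def vcomp_def)
qed

lemma graded_syz:
  assumes hom: "\<And>a b. a < n \<Longrightarrow> homogeneous (sh' a - sh b) (g a b :: ('v::finite, 'k::field) mpoly)"
  shows "graded_submodule n sh' (syz n g)"
  unfolding graded_submodule_def
proof (intro conjI ballI allI)
  show "syz n g \<subseteq> vecs n" by (auto simp: syz_def)
  show "vec.subspace (syz n g)"
    by (rule vec.subspaceI)
      (auto simp: syz_def vecs_def lin_def vscale_def fun_eq_iff distrib_right sum.distrib mult.assoc
        simp flip: sum_distrib_left)
  fix w d assume w: "w \<in> syz n g"
  have "lin n g (vcomp sh' d w) = vcomp sh d (lin n g w)" by (rule lin_vcomp) (rule hom)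
  also have "\<dots> = 0" using w by (simp add: syz_def vcomp_def fun_eq_iff)
  finally have "lin n g (vcomp sh' d w) = 0" .
  then show "vcomp sh' d w \<in> syz n g" using w by (auto simp: syz_def vecs_def vcomp_def)
qed

section \<open>Minimal graded free resolutions\<close>

text \<open>The augmentation and the boundary maps of a resolution in uniform shape, with entries outside the
ranks set to zero, so that each is a map \<open>lin\<close> onto the module of syzygies of the preceding one.\<close>

definition gens :: "'a::comm_ring_1 free_complex \<Rightarrow> nat \<Rightarrow> nat \<Rightarrow> nat \<Rightarrow> 'a" where
  "gens F i a b = (case i of 0 \<Rightarrow> if b = 0 then aug F a else 0
     | Suc j \<Rightarrow> if b < rnk F j then bdry F j a b else 0)"

lemma lin_gens_0: "lin (rnk F 0) (gens F 0) w = (\<lambda>b. if b = 0 then aug_map F w else 0)"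
  by (auto simp: lin_def gens_def aug_map_def fun_eq_iff)

lemma lin_gens_Suc: "lin (rnk F (Suc i)) (gens F (Suc i)) w = bdry_map F i w"
  by (auto simp: lin_def gens_def bdry_map_def fun_eq_iff)

lemma syz_gens_0: "syz (rnk F 0) (gens F 0) = {w \<in> free_mod F 0. aug_map F w = 0}"
  unfolding syz_def lin_gens_0 by (auto simp: vecs_def free_mod_def fun_eq_iff)

lemma syz_gens_Suc:
  "syz (rnk F (Suc i)) (gens F (Suc i)) = {w \<in> free_mod F (Suc i). bdry_map F i w = (\<lambda>_. 0)}"
  unfolding syz_def lin_gens_Suc by (auto simp: vecs_def free_mod_def zero_fun_def)

lemma lin_gens_0_image:
  "lin (rnk F 0) (gens F 0) ` vecs (rnk F 0) = ideal_vecs I \<longleftrightarrow> aug_map F ` free_mod F 0 = I"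
proof -
  let ?h = "\<lambda>p b::nat. if b = 0 then p else 0"
  have "inj ?h" by (rule injI) (metis)
  moreover have "ideal_vecs I = ?h ` I"
    by (auto simp: ideal_vecs_def vecs_def fun_eq_iff image_iff)
  moreover have "lin (rnk F 0) (gens F 0) ` vecs (rnk F 0) = ?h ` aug_map F ` free_mod F 0"
    unfolding lin_gens_0 image_image by (simp add: vecs_def free_mod_def)
  ultimately show ?thesis by (metis inj_image_eq_iff)
qed

lemma coef_mult_const_zero:
  fixes p q :: "('v::finite, 'k::comm_ring_1) mpoly"
  assumes "coef q 0 = 0"
  shows "coef (p * q) 0 = 0"
proof (rule ccontr)
  assume "coef (p * q) 0 \<noteq> 0"
  then obtain k l where "0 = k + l" "coef q l \<noteq> 0" using coef_mult_nonzero by blast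
  moreover from this have "l = 0" by (simp add: fun_eq_iff)
  ultimately show False using assms by simp
qed

text \<open>A minimal resolution is a chain of minimal presentations, each presenting the syzygies of the one
before; minimality of the boundary entries is minimality of the syzygies, which are their
combinations.\<close>

lemma minimal_graded_free_resolution_iff:
  fixes I :: "('v::finite, 'k::field) mpoly set"
  shows "minimal_graded_free_resolution I F \<longleftrightarrow>
    minimal_presentation (ideal_vecs I) (\<lambda>_. 0) (rnk F 0) (shift F 0) (gens F 0) \<and>
    (\<forall>i. minimal_presentation (syz (rnk F i) (gens F i)) (shift F i)
       (rnk F (Suc i)) (shift F (Suc i)) (gens F (Suc i)))" (is "?L \<longleftrightarrow> ?R")
proof -
  have exact: "lin (rnk F (Suc i)) (gens F (Suc i)) ` vecs (rnk F (Suc i)) = syz (rnk F i) (gens F i) \<longleftrightarrow>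
      (case i of 0 \<Rightarrow> bdry_map F 0 ` free_mod F 1 = {w \<in> free_mod F 0. aug_map F w = 0}
       | Suc j \<Rightarrow> bdry_map F (Suc j) ` free_mod F (Suc (Suc j)) =
          {w \<in> free_mod F (Suc j). bdry_map F j w = (\<lambda>_. 0)})" for i
    by (cases i) (simp_all add: lin_gens_Suc syz_gens_0 syz_gens_Suc vecs_def free_mod_def cong: image_cong)
  have hom0: "(\<forall>a<rnk F 0. \<forall>b. homogeneous (shift F 0 a - 0) (gens F 0 a b)) \<longleftrightarrow>
      (\<forall>a<rnk F 0. homogeneous (shift F 0 a) (aug F a))"
    by (auto simp: gens_def)
  have homS: "(\<forall>a<rnk F (Suc i). \<forall>b. homogeneous (shift F (Suc i) a - shift F i b) (gens F (Suc i) a b)) \<longleftrightarrow>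
      (\<forall>a<rnk F (Suc i). \<forall>b<rnk F i. homogeneous (shift F (Suc i) a - shift F i b) (bdry F i a b))" for i
    by (auto simp: gens_def)
  have min: "(\<forall>w\<in>syz (rnk F i) (gens F i). \<forall>a. coef (w a) 0 = 0) \<longleftrightarrow>
      (\<forall>a<rnk F (Suc i). \<forall>b<rnk F i. Poly_Mapping.lookup (bdry F i a b) 0 = 0)"
    if im: "lin (rnk F (Suc i)) (gens F (Suc i)) ` vecs (rnk F (Suc i)) = syz (rnk F i) (gens F i)" for i
  proof (intro iffI allI impI ballI)
    fix a b assume z: "\<forall>w\<in>syz (rnk F i) (gens F i). \<forall>a. coef (w a) 0 = 0"
      and ab: "a < rnk F (Suc i)" "b < rnk F i"
    define u :: "nat \<Rightarrow> ('v, 'k) mpoly" where "u c = (if c = a then 1 else 0)" for c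
    have u: "u \<in> vecs (rnk F (Suc i))" "lin (rnk F (Suc i)) (gens F (Suc i)) u = gens F (Suc i) a"
      using ab by (auto simp: u_def vecs_def lin_def fun_eq_iff if_distrib[of "\<lambda>x. x * _"] cong: if_cong)
    have "gens F (Suc i) a \<in> syz (rnk F i) (gens F i)" using u unfolding im[symmetric] by (metis imageI)
    then have "coef (gens F (Suc i) a b) 0 = 0" using z by blast
    then show "Poly_Mapping.lookup (bdry F i a b) 0 = 0"
      using ab by (simp add: gens_def coef_def zero_fun_def)
  next
    fix w b assume z: "\<forall>a<rnk F (Suc i). \<forall>b<rnk F i. Poly_Mapping.lookup (bdry F i a b) 0 = 0"
      and "w \<in> syz (rnk F i) (gens F i)"
    then obtain u where w: "w = lin (rnk F (Suc i)) (gens F (Suc i)) u" unfolding im[symmetric] by blast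
    have "coef (gens F (Suc i) a b) 0 = 0" if "a < rnk F (Suc i)" for a
      using z that by (simp add: gens_def coef_def zero_fun_def)
    then show "coef (w b) 0 = 0"
      unfolding w lin_def coef_sum by (intro sum.neutral ballI coef_mult_const_zero) simp
  qed
  have nat_split: "(\<forall>i. Q i) \<longleftrightarrow> Q 0 \<and> (\<forall>i. Q (Suc i))" for Q :: "nat \<Rightarrow> bool"
    by (metis nat.exhaust)
  have all_exact: "(\<forall>i. lin (rnk F (Suc i)) (gens F (Suc i)) ` vecs (rnk F (Suc i)) = syz (rnk F i) (gens F i)) \<longleftrightarrow>
      bdry_map F 0 ` free_mod F 1 = {w \<in> free_mod F 0. aug_map F w = 0} \<and>
      (\<forall>i. bdry_map F (Suc i) ` free_mod F (Suc (Suc i)) =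
          {w \<in> free_mod F (Suc i). bdry_map F i w = (\<lambda>_. 0)})"
    unfolding exact by (subst nat_split) simp
  have minall: "(\<forall>i. \<forall>w\<in>syz (rnk F i) (gens F i). \<forall>a. coef (w a) 0 = 0) \<longleftrightarrow>
      (\<forall>i. \<forall>a<rnk F (Suc i). \<forall>b<rnk F i. Poly_Mapping.lookup (bdry F i a b) 0 = 0)"
    if "\<forall>i. lin (rnk F (Suc i)) (gens F (Suc i)) ` vecs (rnk F (Suc i)) = syz (rnk F i) (gens F i)"
    using min that by simp
  have L: "?L \<longleftrightarrow>
      (\<forall>a<rnk F 0. \<forall>b. homogeneous (shift F 0 a - 0) (gens F 0 a b)) \<and>
      (\<forall>i. \<forall>a<rnk F (Suc i). \<forall>b. homogeneous (shift F (Suc i) a - shift F i b) (gens F (Suc i) a b)) \<and>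
      lin (rnk F 0) (gens F 0) ` vecs (rnk F 0) = ideal_vecs I \<and>
      (\<forall>i. lin (rnk F (Suc i)) (gens F (Suc i)) ` vecs (rnk F (Suc i)) = syz (rnk F i) (gens F i)) \<and>
      (\<forall>i. \<forall>w\<in>syz (rnk F i) (gens F i). \<forall>a. coef (w a) 0 = 0)"
    unfolding minimal_graded_free_resolution_def graded_free_resolution_def lin_gens_0_image hom0 homS
    all_exact[symmetric]
    using minall by argo
  have R: "?R \<longleftrightarrow>
      (\<forall>a<rnk F 0. \<forall>b. homogeneous (shift F 0 a - 0) (gens F 0 a b)) \<and>
      (\<forall>i. \<forall>a<rnk F (Suc i). \<forall>b. homogeneous (shift F (Suc i) a - shift F i b) (gens F (Suc i) a b)) \<and>
      lin (rnk F 0) (gens F 0) ` vecs (rnk F 0) = ideal_vecs I \<and>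
      (\<forall>i. lin (rnk F (Suc i)) (gens F (Suc i)) ` vecs (rnk F (Suc i)) = syz (rnk F i) (gens F i)) \<and>
      (\<forall>i. \<forall>w\<in>syz (rnk F i) (gens F i). \<forall>a. coef (w a) 0 = 0)"
    unfolding minimal_presentation_def all_conj_distrib
      nat_split[of "\<lambda>i. \<forall>w\<in>syz (rnk F i) (gens F i). \<forall>a. coef (w a) 0 = 0"]
    by argo
  show ?thesis unfolding L R ..
qed

text \<open>By induction on \<open>i\<close>, the \<open>i\<close>-th syzygies satisfy the vanishing with the bound raised by \<open>i + 1\<close>.\<close>

lemma minimal_resolution_shift_le:
  fixes I :: "('v::finite, 'k::field) mpoly set"
  assumes F: "minimal_graded_free_resolution I F" and bound: "tor_bound (ideal_vecs I) (\<lambda>_. 0) r"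
    and a: "a < rnk F i"
  shows "shift F i a \<le> r + int i"
proof -
  have pres0: "minimal_presentation (ideal_vecs I) (\<lambda>_. 0) (rnk F 0) (shift F 0) (gens F 0)"
    and presS: "\<And>i. minimal_presentation (syz (rnk F i) (gens F i)) (shift F i)
       (rnk F (Suc i)) (shift F (Suc i)) (gens F (Suc i))"
    using F unfolding minimal_graded_free_resolution_iff by blast+
  have syz: "tor_bound (syz (rnk F i) (gens F i)) (shift F i) (r + int i + 1)" for i
  proof (induction i)
    case 0
    show ?case using tor_bound_syz[OF pres0 bound] by simp
  next
    case (Suc i)
    then show ?case using tor_bound_syz[OF presS Suc.IH] by (simp add: add_ac)
  qed
  show ?thesis
  proof (cases i)
    case 0
    then show ?thesis using minimal_presentation_shift_le[OF pres0 bound] a by simp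
  next
    case (Suc j)
    then show ?thesis using minimal_presentation_shift_le[OF presS syz] a by (simp add: add_ac)
  qed
qed

text \<open>Minimal presentations are chosen successively; the next step is always possible, as the vanishing
passes to the syzygies.\<close>

lemma exists_minimal_graded_free_resolution:
  fixes I :: "('v::finite, 'k::field) mpoly set"
  assumes graded: "graded_submodule 1 (\<lambda>_. 0) (ideal_vecs I)"
    and bound: "tor_bound (ideal_vecs I) (\<lambda>_. 0) r"
  shows "\<exists>F. minimal_graded_free_resolution I F"
proof -
  define P where "P i x \<longleftrightarrow> (case x of (m, sh, Z) \<Rightarrow> graded_submodule m sh Z \<and> (\<exists>D. tor_bound Z sh D) \<and>
      (i = 0 \<longrightarrow> x = (1, \<lambda>_. 0, ideal_vecs I)))"
    for i :: nat and x :: "nat \<times> (nat \<Rightarrow> int) \<times> (nat \<Rightarrow> ('v, 'k) mpoly) set"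
  define R where "R x y g \<longleftrightarrow> (case (x, y) of ((m, sh, Z), (n, sh', Z')) \<Rightarrow>
      minimal_presentation Z sh n sh' g \<and> (\<forall>a<n. g a \<in> Z) \<and> Z' = syz n g)"
    for x y :: "nat \<times> (nat \<Rightarrow> int) \<times> (nat \<Rightarrow> ('v, 'k) mpoly) set" and g
  have "\<exists>f. \<forall>i. P i (f i) \<and> (\<exists>g. R (f i) (f (Suc i)) g)"
  proof (rule dependent_nat_choice)
    show "\<exists>x. P 0 x" using graded bound by (auto simp: P_def)
    fix x i assume Px: "P i x"
    obtain m sh Z where x: "x = (m, sh, Z)" by (cases x)
    obtain D where Z: "graded_submodule m sh Z" "tor_bound Z sh D" using Px x by (auto simp: P_def)
    obtain n sh' g where g: "minimal_presentation Z sh n sh' g" "\<forall>a<n. g a \<in> Z"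
      using exists_minimal_presentation[OF Z] by blast
    have "graded_submodule n sh' (syz n g)"
      using g(1) by (intro graded_syz[where sh = sh]) (simp add: minimal_presentation_def)
    then have "P (Suc i) (n, sh', syz n g)"
      using tor_bound_syz[OF g(1) Z(2)] by (auto simp: P_def)
    moreover have "R x (n, sh', syz n g) g" using g by (simp add: R_def x)
    ultimately show "\<exists>y. P (Suc i) y \<and> (\<exists>g. R x y g)" by blast
  qed
  then obtain f where f: "\<And>i. P i (f i)" "\<And>i. \<exists>g. R (f i) (f (Suc i)) g" by blast
  then obtain g where g: "\<And>i. R (f i) (f (Suc i)) (g i)" by metis
  define n sh Z where "n i = fst (f i)" and "sh i = fst (snd (f i))" and "Z i = snd (snd (f i))" for i
  have f_eq: "f i = (n i, sh i, Z i)" for i by (simp add: n_def sh_def Z_def)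
  have pres: "minimal_presentation (Z i) (sh i) (n (Suc i)) (sh (Suc i)) (g i)"
    and gZ: "\<And>a. a < n (Suc i) \<Longrightarrow> g i a \<in> Z i" and ZS: "Z (Suc i) = syz (n (Suc i)) (g i)" for i
    using g[of i] by (auto simp: R_def f_eq)
  have start: "n 0 = 1" "sh 0 = (\<lambda>_. 0)" "Z 0 = ideal_vecs I"
    using f(1)[of 0] by (auto simp: P_def f_eq)
  have Zv: "Z i \<subseteq> vecs (n i)" for i
    using f(1)[of i] by (auto simp: P_def f_eq graded_submodule_def)
  define F where "F = \<lparr>rnk = (\<lambda>i. n (Suc i)), shift = (\<lambda>i. sh (Suc i)), aug = (\<lambda>a. g 0 a 0),
      bdry = (\<lambda>i a b. g (Suc i) a b)\<rparr>"
  have gens: "gens F i a b = g i a b" if "a < n (Suc i)" for i a b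
    using gZ[OF that] Zv[of i] start(1) by (cases i) (auto simp: gens_def F_def vecs_def)
  have lin: "lin (n (Suc i)) (gens F i) = lin (n (Suc i)) (g i)" for i
    by (auto simp: lin_def fun_eq_iff gens)
  then have syz: "syz (n (Suc i)) (gens F i) = syz (n (Suc i)) (g i)" for i
    by (simp add: syz_def)
  have "minimal_presentation (Z i) (sh i) (n (Suc i)) (sh (Suc i)) (gens F i)" for i
    using pres[of i] unfolding minimal_presentation_def lin syz by (simp add: gens)
  then have "minimal_graded_free_resolution I F"
    unfolding minimal_graded_free_resolution_iff
    using start ZS syz by (simp add: F_def) metis
  then show ?thesis by blast
qed

lemma regularity_le:
  fixes I :: "('v::finite, 'k::field) mpoly set"
  assumes "graded_submodule 1 (\<lambda>_. 0) (ideal_vecs I)"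
    and bound: "tor_bound (ideal_vecs I) (\<lambda>_. 0) r"
  shows "regularity I \<le> ereal (real_of_int r)"
  unfolding regularity_def
proof (rule Sup_least)
  fix x assume "x \<in> {ereal (real_of_int (j - int i)) | i j. graded_betti I i j \<noteq> 0}"
  then obtain i j where x: "x = ereal (real_of_int (j - int i))" and nz: "graded_betti I i j \<noteq> 0"
    by blast
  define F where "F = (SOME F. minimal_graded_free_resolution I F)"
  have F: "minimal_graded_free_resolution I F"
    unfolding F_def using exists_minimal_graded_free_resolution[OF assms] by (rule someI_ex)
  have "{a. a < rnk F i \<and> shift F i a = j} \<noteq> {}"
    using nz unfolding graded_betti_def Let_def F_def[symmetric] by (metis card.empty)
  then obtain a where "a < rnk F i" "shift F i a = j" by blast
  with minimal_resolution_shift_le[OF F bound] have "j - int i \<le> r" by fastforce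
  then show "x \<le> ereal (real_of_int r)"
    unfolding x by (simp only: ereal_less_eq of_int_le_iff)
qed

section \<open>Powers of edge ideals as monomial ideals\<close>

interpretation ideal: module "(*) :: 'a::comm_ring_1 \<Rightarrow> 'a \<Rightarrow> 'a"
  by unfold_locales (auto simp: algebra_simps)

abbreviation monomial :: "('v::finite \<Rightarrow> nat) \<Rightarrow> ('v, 'k::comm_ring_1) mpoly" where
  "monomial b \<equiv> Poly_Mapping.single (Abs_poly_mapping b) 1"

lemma coef_monomial: "coef (monomial m :: ('v::finite, 'k::comm_ring_1) mpoly) b = (if b = m then 1 else 0)"
proof -
  have "Abs_poly_mapping m = Abs_poly_mapping b \<longleftrightarrow> b = m" by (metis lookup_Abs)
  then show ?thesis by (simp add: coef_def lookup_single when_def)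
qed

lemma monomial_add:
  "(monomial (m + n) :: ('v::finite, 'k::comm_ring_1) mpoly) = monomial m * monomial n"
proof -
  have "Abs_poly_mapping (m + n) = Abs_poly_mapping m + Abs_poly_mapping n"
    by (rule poly_mapping_eqI) (simp add: lookup_add)
  then show ?thesis by (simp add: mult_single)
qed

lemma subspace_mon_ideal:
  assumes "up_closed U"
  shows "ideal.subspace (mon_ideal U :: ('v::finite, 'k::comm_ring_1) mpoly set)"
proof (rule ideal.subspaceI)
  fix p q :: "('v, 'k) mpoly"
  show "0 \<in> (mon_ideal U :: ('v, 'k) mpoly set)" by (simp add: mon_ideal_def)
  show "p + q \<in> mon_ideal U" if "p \<in> mon_ideal U" "q \<in> mon_ideal U"
    using that by (force simp: mon_ideal_def coef_add)
  show "p * q \<in> mon_ideal U" if q: "q \<in> mon_ideal U"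
    unfolding mon_ideal_def
  proof (intro CollectI allI impI)
    fix b assume "coef (p * q) b \<noteq> 0"
    then obtain k l where "b = k + l" "coef q l \<noteq> 0" using coef_mult_nonzero by blast
    moreover from this have "l \<in> U" "l \<le> b" using q by (auto simp: mon_ideal_def le_fun_def)
    ultimately show "b \<in> U" using assms unfolding up_closed_def by blast
  qed
qed

text \<open>A polynomial all of whose monomials are multiples of elements of \<open>M\<close> is the sum of its terms.\<close>

lemma ideal_gen_monomials:
  "ideal_gen (monomial ` M) = (mon_ideal (multiples M) :: ('v::finite, 'k::comm_ring_1) mpoly set)"
proof
  show "ideal_gen (monomial ` M) \<subseteq> (mon_ideal (multiples M) :: ('v, 'k) mpoly set)"
    by (rule ideal.span_minimal[OF _ subspace_mon_ideal[OF up_closed_multiples]])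
      (auto simp: mon_ideal_def coef_monomial multiples_def split: if_splits)
  show "(mon_ideal (multiples M) :: ('v, 'k) mpoly set) \<subseteq> ideal_gen (monomial ` M)"
  proof
    fix p :: "('v, 'k) mpoly" assume p: "p \<in> mon_ideal (multiples M)"
    have "Poly_Mapping.single k (Poly_Mapping.lookup p k) \<in> ideal_gen (monomial ` M)"
      if k: "k \<in> Poly_Mapping.keys p" for k
    proof -
      have "coef p (Poly_Mapping.lookup k) \<noteq> 0" using k by (simp add: coef_lookup in_keys_iff)
      then obtain m where m: "m \<in> M" "m \<le> Poly_Mapping.lookup k"
        using p by (auto simp: mon_ideal_def multiples_def)
      have "Abs_poly_mapping (Poly_Mapping.lookup k - m) + Abs_poly_mapping m = k"
        using m(2) by (intro poly_mapping_eqI) (simp add: lookup_add le_fun_def)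
      then have "Poly_Mapping.single k (Poly_Mapping.lookup p k) =
          Poly_Mapping.single (Abs_poly_mapping (Poly_Mapping.lookup k - m)) (Poly_Mapping.lookup p k) * monomial m"
        by (simp add: mult_single)
      also have "\<dots> \<in> ideal_gen (monomial ` M)"
        using m(1) by (intro ideal.span_scale ideal.span_base) simp
      finally show ?thesis .
    qed
    then have "(\<Sum>k\<in>Poly_Mapping.keys p. Poly_Mapping.single k (Poly_Mapping.lookup p k)) \<in> ideal_gen (monomial ` M)"
      by (rule ideal.span_sum)
    then show "p \<in> ideal_gen (monomial ` M)" by (simp flip: poly_sum_keys)
  qed
qed

lemma ideal_mult_mon_ideal:
  "ideal_mult (mon_ideal (multiples M)) (mon_ideal (multiples N)) =
    (mon_ideal (multiples {m + n | m n. m \<in> M \<and> n \<in> N}) :: ('v::finite, 'k::comm_ring_1) mpoly set)"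
  (is "_ = mon_ideal (multiples ?MN)")
proof
  show "ideal_mult (mon_ideal (multiples M)) (mon_ideal (multiples N)) \<subseteq>
      (mon_ideal (multiples ?MN) :: ('v, 'k) mpoly set)"
    unfolding ideal_mult_def
  proof (rule ideal.span_minimal[OF _ subspace_mon_ideal[OF up_closed_multiples]], clarify)
    fix p q :: "('v, 'k) mpoly"
    assume pq: "p \<in> mon_ideal (multiples M)" "q \<in> mon_ideal (multiples N)"
    show "p * q \<in> mon_ideal (multiples ?MN)"
      unfolding mon_ideal_def
    proof (intro CollectI allI impI)
      fix b assume "coef (p * q) b \<noteq> 0"
      then obtain k l where b: "b = k + l" "coef p k \<noteq> 0" "coef q l \<noteq> 0"
        using coef_mult_nonzero by blast
      then have "k \<in> multiples M" "l \<in> multiples N" using pq by (auto simp: mon_ideal_def)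
      then obtain m n where "m \<in> M" "m \<le> k" "n \<in> N" "n \<le> l" unfolding multiples_def by blast
      moreover from this have "m + n \<le> b" unfolding b(1) by (auto simp: le_fun_def intro: add_mono)
      ultimately show "b \<in> multiples ?MN" by (auto simp: multiples_def)
    qed
  qed
  have base: "monomial m \<in> (mon_ideal (multiples L) :: ('v, 'k) mpoly set)" if "m \<in> L" for m L
    unfolding ideal_gen_monomials[symmetric] using that by (intro ideal.span_base) simp
  show "(mon_ideal (multiples ?MN) :: ('v, 'k) mpoly set) \<subseteq>
      ideal_mult (mon_ideal (multiples M)) (mon_ideal (multiples N))"
    unfolding ideal_gen_monomials[symmetric, of ?MN] ideal_mult_def
  proof (rule ideal.span_mono, clarify)
    fix m n assume "m \<in> M" "n \<in> N"
    then show "\<exists>a b. (monomial (m + n) :: ('v, 'k) mpoly) = a * b \<and>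
        a \<in> mon_ideal (multiples M) \<and> b \<in> mon_ideal (multiples N)"
      using monomial_add base by blast
  qed
qed

lemma ideal_power_mon_ideal:
  assumes I: "I = (mon_ideal (multiples (edge_sums E 1)) :: ('v::finite, 'k::comm_ring_1) mpoly set)"
  shows "ideal_power I s = mon_ideal (multiples (edge_sums E s))"
proof (induction s)
  case 0
  show ?case by (auto simp: mon_ideal_def multiples_def le_fun_def)
next
  case (Suc s)
  have "{m + n | m n. m \<in> edge_sums E 1 \<and> n \<in> edge_sums E s} = edge_sums E (Suc s)"
  proof (intro Set.set_eqI iffI)
    fix u assume "u \<in> {m + n | m n. m \<in> edge_sums E 1 \<and> n \<in> edge_sums E s}"
    then obtain a b n where u: "u = (unit_vec a + unit_vec b) + n" "(a, b) \<in> E" "n \<in> edge_sums E s"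
      by (auto simp: edge_sums.simps)
    have "u = n + unit_vec a + unit_vec b" unfolding u(1) by (simp only: add_ac)
    then show "u \<in> edge_sums E (Suc s)" using edge_sums_SucI[OF u(3,2)] by simp
  next
    fix u assume "u \<in> edge_sums E (Suc s)"
    then obtain a b n where u: "u = n + unit_vec a + unit_vec b" "(a, b) \<in> E" "n \<in> edge_sums E s"
      by (auto simp: edge_sums.simps)
    have "0 + unit_vec a + unit_vec b \<in> edge_sums E (Suc 0)"
      using u(2) by (intro edge_sums_SucI) simp_all
    moreover have "u = (0 + unit_vec a + unit_vec b) + n" unfolding u(1) by (simp only: add_ac add_0_left)
    ultimately show "u \<in> {m + n | m n. m \<in> edge_sums E 1 \<and> n \<in> edge_sums E s}"
      using u(3) unfolding One_nat_def by blast
  qed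
  then show ?case using Suc by (simp add: I ideal_mult_mon_ideal)
qed

lemma graded_ideal_vecs:
  assumes "up_closed U"
  shows "graded_submodule 1 (\<lambda>_. 0) (ideal_vecs (mon_ideal U) :: (nat \<Rightarrow> ('v::finite, 'k::field) mpoly) set)"
  unfolding graded_submodule_def
proof (intro conjI ballI allI)
  note sub = subspace_mon_ideal[OF assms, where 'k = 'k]
  show "vec.subspace (ideal_vecs (mon_ideal U) :: (nat \<Rightarrow> ('v, 'k) mpoly) set)"
    using ideal.subspace_0[OF sub] ideal.subspace_add[OF sub] ideal.subspace_scale[OF sub]
    by (intro vec.subspaceI) (auto simp: ideal_vecs_def vecs_def vscale_def)
  fix w :: "nat \<Rightarrow> ('v, 'k) mpoly" and d assume "w \<in> ideal_vecs (mon_ideal U)"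
  then show "vcomp (\<lambda>_. 0) d w \<in> ideal_vecs (mon_ideal U)"
    by (auto simp: ideal_vecs_def vecs_def vcomp_def mon_ideal_def coef_hcomp)
qed (auto simp: ideal_vecs_def)

lemma regularity_mon_ideal_le:
  assumes "up_closed U" "reg_le TYPE('k::field) U r"
  shows "regularity (mon_ideal U :: ('v::finite, 'k) mpoly set) \<le> ereal (real_of_int r)"
  by (intro regularity_le graded_ideal_vecs tor_bound_mon_ideal assms)

section \<open>Co-chordal covers of bipartite graphs\<close>

text \<open>Two edges \<open>ab\<close> and \<open>cd\<close> that form an induced matching make \<open>a, c, b, d\<close> an induced four-cycle of the
complement, since the vertices on one side of a bipartite graph are pairwise non-adjacent.\<close>

lemma co_chordal_chain_rel:
  assumes H: "subgraph H G" "co_chordal H" and AB: "A \<inter> B = {}"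
    and bip: "\<And>e. e \<in> edges G \<Longrightarrow> \<exists>a\<in>A. \<exists>b\<in>B. e = {a, b}"
  shows "chain_rel {(a, b). a \<in> A \<and> b \<in> B \<and> {a, b} \<in> edges H}"
  unfolding chain_rel_def
proof (intro allI impI, rule ccontr)
  fix a b c d
  let ?R = "{(a, b). a \<in> A \<and> b \<in> B \<and> {a, b} \<in> edges H}"
  assume ab: "(a, b) \<in> ?R" and cd: "(c, d) \<in> ?R" and no: "\<not> ((a, d) \<in> ?R \<or> (c, b) \<in> ?R)"
  have inH: "e \<subseteq> verts H" "e \<in> edges G" if "e \<in> edges H" for e
    using H(1) that by (auto simp: subgraph_def simple_graph_def)
  have sides: "a \<in> A" "c \<in> A" "b \<in> B" "d \<in> B" using ab cd by auto
  have ne: "a \<noteq> b" "a \<noteq> d" "c \<noteq> b" "c \<noteq> d" "a \<noteq> c" "b \<noteq> d"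
    using sides AB ab cd no by auto
  have edges: "{a, b} \<in> edges H" "{c, d} \<in> edges H" "{a, d} \<notin> edges H" "{c, b} \<notin> edges H"
    using ab cd no sides by auto
  have same: "{a, c} \<notin> edges H" "{b, d} \<notin> edges H"
  proof -
    have "e \<inter> A \<noteq> {} \<and> e \<inter> B \<noteq> {}" if "e \<in> edges H" for e
      using bip[OF inH(2)[OF that]] by blast
    moreover have "{a, c} \<inter> B = {}" "{b, d} \<inter> A = {}" using sides AB by auto
    ultimately show "{a, c} \<notin> edges H" "{b, d} \<notin> edges H" by blast+
  qed
  have v: "a \<in> verts H" "b \<in> verts H" "c \<in> verts H" "d \<in> verts H"
    using inH(1)[OF edges(1)] inH(1)[OF edges(2)] by auto
  let ?C = "edges (complement_graph H)"
  have adj: "{x, y} \<in> ?C \<longleftrightarrow> x \<noteq> y \<and> {x, y} \<notin> edges H" if "x \<in> verts H" "y \<in> verts H" for x y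
    using that by (simp add: complement_graph_def card_insert_if)
  have loop: "{x} \<notin> ?C" for x by (simp add: complement_graph_def)
  have edges_flip: "{b, a} \<in> edges H" "{d, c} \<in> edges H" "{d, a} \<notin> edges H" "{b, c} \<notin> edges H"
    and same_flip: "{c, a} \<notin> edges H" "{d, b} \<notin> edges H"
    using edges same by (simp_all add: insert_commute)
  have "induced_cycle (complement_graph H) [a, c, b, d]"
    unfolding induced_cycle_def
  proof (intro conjI allI impI)
    show "distinct [a, c, b, d]" using ne by auto
    show "set [a, c, b, d] \<subseteq> verts (complement_graph H)" using v by (simp add: complement_graph_def)
    fix i j assume "i < length [a, c, b, d]" "j < length [a, c, b, d]"
    then have "i \<in> {0, 1, 2, 3}" "j \<in> {0, 1, 2, 3}" by auto
    then show "{[a, c, b, d] ! i, [a, c, b, d] ! j} \<in> ?C \<longleftrightarrow>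
        j = (i + 1) mod length [a, c, b, d] \<or> i = (j + 1) mod length [a, c, b, d]"
      by (elim insertE emptyE)
        (simp_all add: adj loop v ne ne[symmetric] edges same edges_flip same_flip)
  qed simp
  then have "length [a, c, b, d] = 3"
    using H(2) unfolding co_chordal_def chordal_def by blast
  then show False by simp
qed

text \<open>The minimum in the definition of the co-chordal cover number is attained, since a cover exists: a
graph with a single edge and its two vertices is co-chordal, as its complement has too few vertices
for a cycle.\<close>

lemma co_chord_cover:
  assumes "simple_graph G"
  shows "\<exists>H. (\<forall>i<co_chord G. subgraph (H i) G \<and> co_chordal (H i)) \<and>
    edges G = (\<Union>i<co_chord G. edges (H i))"
  unfolding co_chord_def
proof (rule LeastI_ex)
  have fin: "finite (edges G)"
    using assms by (intro finite_subset[of "edges G" "Pow (verts G)"]) (auto simp: simple_graph_def)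
  obtain n :: nat and f where f: "edges G = f ` {i. i < n}"
    using finite_conv_nat_seg_image[THEN iffD1, OF fin] by (elim exE)
  let ?H = "\<lambda>i. \<lparr>verts = f i, edges = {f i}\<rparr>"
  have "subgraph (?H i) G \<and> co_chordal (?H i)" if "i < n" for i
  proof
    have e: "f i \<in> edges G" using f that by simp
    then have card: "f i \<subseteq> verts G" "card (f i) = 2" using assms by (auto simp: simple_graph_def)
    then have "finite (f i)" by (metis card.infinite zero_neq_numeral)
    with e card show "subgraph (?H i) G" by (simp add: subgraph_def simple_graph_def)
    have False if "induced_cycle (complement_graph (?H i)) c" for c
    proof -
      have "length c \<ge> 3" "distinct c" "set c \<subseteq> f i"
        using that by (auto simp: induced_cycle_def complement_graph_def)
      then show False
        using card_mono[OF \<open>finite (f i)\<close>, of "set c"] card(2) by (simp add: distinct_card)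
    qed
    then show "co_chordal (?H i)" by (auto simp: co_chordal_def chordal_def)
  qed
  then have "\<forall>i<n. subgraph (?H i) G \<and> co_chordal (?H i)" by blast
  moreover have "edges G = (\<Union>i<n. edges (?H i))"
    unfolding f by auto
  ultimately show "\<exists>(n::nat) H. (\<forall>i<n. subgraph (H i) G \<and> co_chordal (H i)) \<and> edges G = (\<Union>i<n. edges (H i))"
    by (intro exI[of _ n] exI[of _ ?H] conjI)
qed

lemma chain_cover_co_chord:
  assumes G: "simple_graph G" and AB: "A \<inter> B = {}"
    and bip: "\<And>e. e \<in> edges G \<Longrightarrow> \<exists>a\<in>A. \<exists>b\<in>B. e = {a, b}"
  shows "chain_cover {(a, b). a \<in> A \<and> b \<in> B \<and> {a, b} \<in> edges G} (co_chord G)"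
proof -
  obtain H where H: "\<And>i. i < co_chord G \<Longrightarrow> subgraph (H i) G \<and> co_chordal (H i)"
    "edges G = (\<Union>i<co_chord G. edges (H i))"
    using co_chord_cover[OF G] by blast
  let ?R = "\<lambda>i. {(a, b). a \<in> A \<and> b \<in> B \<and> {a, b} \<in> edges (H i)}"
  have "\<forall>i<co_chord G. chain_rel (?R i)"
    using H(1) co_chordal_chain_rel[OF _ _ AB bip] by blast
  moreover have "{(a, b). a \<in> A \<and> b \<in> B \<and> {a, b} \<in> edges G} = (\<Union>i<co_chord G. ?R i)"
    unfolding H(2) by blast
  ultimately show ?thesis unfolding chain_cover_def by (intro exI[of _ ?R] conjI)
qed

lemma edge_ideal_mon_ideal:
  assumes AB: "A \<inter> B = {}" and bip: "\<And>e. e \<in> edges G \<Longrightarrow> \<exists>a\<in>A. \<exists>b\<in>B. e = {a, b}"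
  shows "edge_ideal G = (mon_ideal (multiples (edge_sums {(a, b). a \<in> A \<and> b \<in> B \<and> {a, b} \<in> edges G} 1))
    :: ('v::finite, 'k::comm_ring_1) mpoly set)"
proof -
  let ?E = "{(a, b). a \<in> A \<and> b \<in> B \<and> {a, b} \<in> edges G}"
  have X: "(X u * X v :: ('v, 'k) mpoly) = monomial (unit_vec u + unit_vec v)" for u v
  proof -
    have "Poly_Mapping.single w 1 = Abs_poly_mapping (unit_vec w)" for w :: 'v
      by (rule poly_mapping_eqI) (simp add: lookup_single ind_def when_def)
    then show ?thesis by (simp add: X_def monomial_add)
  qed
  have E1: "edge_sums ?E 1 = {unit_vec a + unit_vec b | a b. (a, b) \<in> ?E}"
    by (auto simp: edge_sums.simps)
  have "{X u * X v :: ('v, 'k) mpoly | u v. {u, v} \<in> edges G} = monomial ` edge_sums ?E 1"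
  proof (intro Set.set_eqI iffI)
    fix p :: "('v, 'k) mpoly" assume "p \<in> {X u * X v | u v. {u, v} \<in> edges G}"
    then obtain u v where uv: "p = X u * X v" "{u, v} \<in> edges G" by blast
    then obtain a b where ab: "a \<in> A" "b \<in> B" "{u, v} = {a, b}" using bip by blast
    then have "p = X a * X b" using uv(1) by (auto simp: doubleton_eq_iff mult.commute)
    moreover have "(a, b) \<in> ?E" using ab uv(2) by simp
    ultimately show "p \<in> monomial ` edge_sums ?E 1" unfolding E1 X by blast
  next
    fix p :: "('v, 'k) mpoly" assume "p \<in> monomial ` edge_sums ?E 1"
    then show "p \<in> {X u * X v | u v. {u, v} \<in> edges G}" unfolding E1 X by blast
  qed
  then show ?thesis unfolding edge_ideal_def by (simp only: ideal_gen_monomials)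
qed

section \<open>Regularity of powers of edge ideals\<close>

theorem theorem1p1:
  fixes G :: "'v::finite ugraph" and s :: nat
  assumes "simple_graph G" and "verts G = UNIV"
    and "bipartite G"
    and "s \<ge> 1"
  shows "regularity (ideal_power (edge_ideal G :: ('v, 'k::field) mpoly set) s)
           \<le> ereal (2 * real s + real (co_chord G) - 1)"
proof -
  obtain A B where AB: "A \<inter> B = {}" and all: "\<forall>e\<in>edges G. \<exists>a\<in>A. \<exists>b\<in>B. e = {a, b}"
    using assms(3) unfolding bipartite_def by (elim exE conjE) (rule that)
  have bip: "\<exists>a\<in>A. \<exists>b\<in>B. e = {a, b}" if "e \<in> edges G" for e using all that by (rule bspec)
  define E where "E = {(a, b). a \<in> A \<and> b \<in> B \<and> {a, b} \<in> edges G}"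
  interpret bipartition A B E using AB by unfold_locales (auto simp: E_def)
  have "chain_cover E (co_chord G)"
    unfolding E_def by (rule chain_cover_co_chord[OF assms(1) AB bip])
  from reg_le_edge_sums[OF this assms(4)]
  have "regularity (mon_ideal (multiples (edge_sums E s)) :: ('v, 'k) mpoly set) \<le>
      ereal (real_of_int (2 * int s + int (co_chord G) - 1))"
    by (intro regularity_mon_ideal_le up_closed_multiples)
  moreover have "ideal_power (edge_ideal G :: ('v, 'k) mpoly set) s = mon_ideal (multiples (edge_sums E s))"
    unfolding E_def by (rule ideal_power_mon_ideal[OF edge_ideal_mon_ideal[OF AB bip]])
  ultimately show ?thesis by simp
qed

end
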